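(* Let $P$ be a pure partition poset. If $P$ has a $\Pi$-shelling, then $P$ has a nonnegative $h$-vector, and hence the chain polynomials of $P$ and of its rank-selected subposets $P_S=\{x\in P:\rho(x)\in S\}$, $S\subseteq\mathbb{N}$, are real-rooted.
   Context: Partition posets: the dual partition lattice $\Pi_{n+1}'$ of rank $n$ is the poset of all set partitions of $[n+1]=\{1,\dots,n+1\}$, with $\pi\le\sigma$ if every block of $\sigma$ is contained in a block of $\pi$ (a partition with $k+1$ blocks has rank $k$). A finite poset $P$ with a least element is a partition poset if for every $x\in P$ the principal order ideal $\langle x\rangle=\{z\in P:z\le x\}$ is isomorphic to $\Pi'_{m+1}$ for some $m$; then $\rho(x)=m$ is the rank of $x$ and the rank $\rho(P)$ is the maximal rank of an element. A finite poset is pure if all its maximal chains have the same length; facets are maximal elements. $h$-vector: let $(t)_k=t(t-1)\cdots(t-k+1)$ and let $\mathcal{S}:\mathbb{R}[t]\to\mathbb{R}[t]$ be the linear map with $\mathcal{S}((t)_k)=t^k$ for all $k\in\mathbb{N}$. Put $R_{n,k}(t)=\mathcal{S}\big(t^{n-k}(t)_{k+1}\big)/t$ for $0\le k\le n$. The $h$-vector of a partition poset $P$ of rank $n$ is the unique vector $(h_0(P),\dots,h_n(P))$ with $\sum_{x\in P}t^{\rho(x)}=\sum_{k=0}^n h_k(P)R_{n,k}(t)$; it is nonnegative if all $h_k(P)\ge0$. $\Pi$-shelling: let $P$ be a pure partition poset of rank $n$. A total order $y_1,\dots,y_m$ of the facets of $P$ is a $\Pi$-shelling if (S1) for each $j>1$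 the subposet $H_j=\langle y_j\rangle\cap\bigcup_{i<j}\langle y_i\rangle$ of $\langle y_j\rangle$ is pure of rank $n-1$; and (C) for each $1<j\le m$ the graph $G(y_j)$ is chordal. Here $G(y_j)$ is the following simple graph on vertex set $[n+1]$: identify $\langle y_j\rangle$ with $\Pi'_{n+1}$ via an isomorphism; each facet of $H_j$ has rank $n-1$, hence corresponds to a partition of $[n+1]$ with exactly one two-element block $\{a,b\}$ and all other blocks singletons; the edges of $G(y_j)$ are the pairs $\{a,b\}$ so obtained. A graph is chordal if it is empty (no vertices), or it has a vertex $v$ whose neighbors form a clique and such that $G\setminus v$ is chordal. The chain polynomial of a finite poset $Q$ is $c_Q(t)=\sum_C t^{|C|}$, the sum over all chains $C$ in $Q$ (including the empty one). Real-rooted means all complex zeros are real (nonzero constants count as real-rooted). *)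

theory Defs
  imports
    Complex_Main
    "HOL-Library.Disjoint_Sets"
    "HOL-Computational_Algebra.Polynomial"
begin

text \<open>
  A poset is a carrier set \<open>P\<close> together with a relation \<open>r\<close> such that
  \<open>partial_order_on P r\<close>; a pair \<open>(x, y) \<in> r\<close> means \<open>x \<le> y\<close>. A subposet is given by a
  smaller carrier with the same relation, so every notion below looks at \<open>r\<close> on its
  carrier only.
\<close>

section \<open>Posets\<close>

definition poset_iso :: "'a set \<Rightarrow> 'a rel \<Rightarrow> 'b set \<Rightarrow> 'b rel \<Rightarrow> ('a \<Rightarrow> 'b) \<Rightarrow> bool" where
  "poset_iso P r Q s f \<longleftrightarrow>
     bij_betw f P Q \<and> (\<forall>x\<in>P. \<forall>y\<in>P. (x, y) \<in> r \<longleftrightarrow> (f x, f y) \<in> s)"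

definition principal_ideal :: "'a set \<Rightarrow> 'a rel \<Rightarrow> 'a \<Rightarrow> 'a set" where
  "principal_ideal P r x = {z \<in> P. (z, x) \<in> r}"

definition facets :: "'a set \<Rightarrow> 'a rel \<Rightarrow> 'a set" where
  "facets P r = {x \<in> P. \<forall>y\<in>P. (x, y) \<in> r \<longrightarrow> y = x}"

text \<open>
  The library constants for chains accept reflexive as well as strict orders.
  The length of a chain is its cardinality minus one, so comparing cardinalities is enough.
\<close>

abbreviation poset_chain :: "'a set \<Rightarrow> 'a rel \<Rightarrow> 'a set \<Rightarrow> bool" where
  "poset_chain P r \<equiv> pred_on.chain P (\<lambda>x y. (x, y) \<in> r)"

abbreviation poset_maxchain :: "'a set \<Rightarrow> 'a rel \<Rightarrow> 'a set \<Rightarrow> bool" where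
  "poset_maxchain P r \<equiv> pred_on.maxchain P (\<lambda>x y. (x, y) \<in> r)"

definition pure_poset :: "'a set \<Rightarrow> 'a rel \<Rightarrow> bool" where
  "pure_poset P r \<longleftrightarrow>
     (\<forall>C D. poset_maxchain P r C \<and> poset_maxchain P r D \<longrightarrow> card C = card D)"

definition chain_poly :: "'a set \<Rightarrow> 'a rel \<Rightarrow> real poly" where
  "chain_poly P r = (\<Sum>C | poset_chain P r C. monom 1 (card C))"

definition real_rooted :: "real poly \<Rightarrow> bool" where
  "real_rooted p \<longleftrightarrow> (\<forall>z::complex. poly (map_poly complex_of_real p) z = 0 \<longrightarrow> z \<in> \<real>)"


section \<open>Partition posets\<close>

definition dual_partitions :: "nat \<Rightarrow> nat set set set" where
  "dual_partitions n = {\<pi>. partition_on {1..n + 1} \<pi>}"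

text \<open>\<open>\<pi> \<le> \<sigma>\<close> iff \<open>\<sigma>\<close> refines \<open>\<pi>\<close>: the one-block partition is the least element.\<close>

definition dual_partition_order :: "nat \<Rightarrow> nat set set rel" where
  "dual_partition_order n = {(\<pi>, \<sigma>). refines {1..n + 1} \<sigma> \<pi>}"

definition dual_partition_iso ::
    "'a set \<Rightarrow> 'a rel \<Rightarrow> nat \<Rightarrow> ('a \<Rightarrow> nat set set) \<Rightarrow> bool" where
  "dual_partition_iso P r n \<phi> \<longleftrightarrow>
     poset_iso P r (dual_partitions n) (dual_partition_order n) \<phi>"

definition partition_poset :: "'a set \<Rightarrow> 'a rel \<Rightarrow> bool" where
  "partition_poset P r \<longleftrightarrow>
     finite P \<and> partial_order_on P r \<and> (\<exists>b\<in>P. \<forall>x\<in>P. (b, x) \<in> r) \<and>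
     (\<forall>x\<in>P. \<exists>m \<phi>. dual_partition_iso (principal_ideal P r x) r m \<phi>)"

definition rank_of :: "'a set \<Rightarrow> 'a rel \<Rightarrow> 'a \<Rightarrow> nat" where
  "rank_of P r x = (THE m. \<exists>\<phi>. dual_partition_iso (principal_ideal P r x) r m \<phi>)"

definition poset_rank :: "'a set \<Rightarrow> 'a rel \<Rightarrow> nat" where
  "poset_rank P r = Max (rank_of P r ` P)"

definition rank_selected :: "'a set \<Rightarrow> 'a rel \<Rightarrow> nat set \<Rightarrow> 'a set" where
  "rank_selected P r S = {x \<in> P. rank_of P r x \<in> S}"


section \<open>The h-vector\<close>

definition falling_poly :: "nat \<Rightarrow> real poly" where
  "falling_poly k = (\<Prod>i<k. [:- real i, 1:])"

text \<open>
  The falling factorials form a basis of the space of polynomials, so the following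
  operator exists and is unique.
\<close>

definition subdiv_op :: "real poly \<Rightarrow> real poly" where
  "subdiv_op = (THE F. Vector_Spaces.linear smult smult F \<and>
                       (\<forall>k. F (falling_poly k) = monom 1 k))"

definition R_poly :: "nat \<Rightarrow> nat \<Rightarrow> real poly" where
  "R_poly n k = subdiv_op (monom 1 (n - k) * falling_poly (k + 1)) div monom 1 1"

text \<open>
  For fixed \<open>n\<close> the polynomials \<open>R_poly n 0, \<dots>, R_poly n n\<close> form a basis of the space of
  polynomials of degree at most \<open>n\<close>. The vector is stored as a function on the natural
  numbers; it is set to zero beyond \<open>n\<close> so that it is unique as a function.
\<close>

definition h_vector :: "'a set \<Rightarrow> 'a rel \<Rightarrow> nat \<Rightarrow> real" where
  "h_vector P r =
     (THE h. (\<forall>k > poset_rank P r. h k = 0) \<and>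
             (\<Sum>x\<in>P. monom 1 (rank_of P r x)) =
             (\<Sum>k\<le>poset_rank P r. smult (h k) (R_poly (poset_rank P r) k)))"

definition nonneg_h_vector :: "'a set \<Rightarrow> 'a rel \<Rightarrow> bool" where
  "nonneg_h_vector P r \<longleftrightarrow> (\<forall>k\<le>poset_rank P r. h_vector P r k \<ge> 0)"


section \<open>Chordal graphs and shellings\<close>

text \<open>
  A simple graph is a vertex set with a set of two-element edges. The second rule deletes
  a vertex \<open>v\<close> whose neighbours form a clique.
\<close>

inductive chordal :: "'v set \<Rightarrow> 'v set set \<Rightarrow> bool" where
  empty: "chordal {} {}"
| simplicial: "\<lbrakk>v \<in> V;
     \<And>a b. \<lbrakk>{v, a} \<in> E; {v, b} \<in> E; a \<noteq> b\<rbrakk> \<Longrightarrow> {a, b} \<in> E;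
     chordal (V - {v}) {e \<in> E. v \<notin> e}\<rbrakk> \<Longrightarrow> chordal V E"

definition shelling_subposet :: "'a set \<Rightarrow> 'a rel \<Rightarrow> 'a list \<Rightarrow> nat \<Rightarrow> 'a set" where
  "shelling_subposet P r ys j =
     principal_ideal P r (ys ! j) \<inter> (\<Union>i<j. principal_ideal P r (ys ! i))"

text \<open>
  The edges of the graph attached to a subposet \<open>H\<close> of a copy of the dual partition
  lattice of rank \<open>n\<close>, where \<open>\<phi>\<close> identifies that copy with the lattice itself.
\<close>

definition graph_edges :: "nat \<Rightarrow> ('a \<Rightarrow> nat set set) \<Rightarrow> 'a set \<Rightarrow> 'a rel \<Rightarrow> nat set set" where
  "graph_edges n \<phi> H r =
     {{a, b} | a b. a \<in> {1..n + 1} \<and> b \<in> {1..n + 1} \<and> a \<noteq> b \<and>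
        (\<exists>z\<in>facets H r. \<phi> z = insert {a, b} ((\<lambda>c. {c}) ` ({1..n + 1} - {a, b})))}"

text \<open>
  The list \<open>ys\<close> is indexed from \<open>0\<close>, so the conditions concern \<open>0 < j\<close>. The subposets in
  the first condition are order ideals of \<open>P\<close>; hence their elements have the same rank
  there as in \<open>P\<close>. Different choices of \<open>\<phi>\<close> lead to isomorphic graphs.
\<close>

definition Pi_shelling :: "'a set \<Rightarrow> 'a rel \<Rightarrow> 'a list \<Rightarrow> bool" where
  "Pi_shelling P r ys \<longleftrightarrow>
     distinct ys \<and> set ys = facets P r \<and>
     (\<forall>j. 0 < j \<and> j < length ys \<longrightarrow>
        pure_poset (shelling_subposet P r ys j) r \<and>
        poset_rank (shelling_subposet P r ys j) r + 1 = poset_rank P r) \<and>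
     (\<forall>j. 0 < j \<and> j < length ys \<longrightarrow>
        (\<exists>\<phi>. dual_partition_iso (principal_ideal P r (ys ! j)) r (poset_rank P r) \<phi> \<and>
             chordal {1..poset_rank P r + 1}
               (graph_edges (poset_rank P r) \<phi> (shelling_subposet P r ys j) r)))"

end

theory Submission
  imports Defs
begin

text \<open>
  Write \<open>T f = t f + t f'\<close>; then \<open>subdiv_op (t p) = T (subdiv_op p)\<close>, so
  \<open>t R_poly n k = T ^ (n - k) t ^ (k + 1)\<close>.
  The elements of \<open>\<langle>y\<^sub>j\<rangle>\<close> outside \<open>H\<^sub>j\<close> correspond to the partitions of the vertices of \<open>G(y\<^sub>j)\<close>
  into independent sets. Attaching a simplicial vertex of degree \<open>d\<close> to a graph applies \<open>T - d\<close> to the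
  generating polynomial of these partitions, and \<open>T - d\<close> maps the cone spanned by the \<open>R_poly n k\<close> with
  \<open>k + 1\<close> at least the clique number to the corresponding cone for the larger graph. Hence every step of
  the shelling contributes a nonnegative vector to \<open>h\<close>.

  For the zeros, chains are enumerated by their maximum. This turns
  \<open>R_poly n k = R_poly n (k + 1) + (k + 1) R_poly (n - 1) k\<close> into a recursion for polynomials
  \<open>W n k\<close> of which the chain polynomial is the combination with coefficients \<open>h k\<close>.
  At a point \<open>z\<close> of the upper half plane, with \<open>u = z / (1 + z)\<close>, the recursion keeps the values
  \<open>W n 0, \<dots>, W n n\<close> in increasing order of argument within an angle \<open>arg u < \<pi>\<close>, so no nonnegative
  combination with a nonzero first term vanishes at \<open>z\<close>.
\<close>

section \<open>The operator \<open>T\<close> and the polynomials \<open>R_poly\<close>\<close>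

text \<open>Since \<open>t (t)_k = (t)_(k+1) + k (t)_k\<close>, multiplication by \<open>t\<close>
  becomes, under the subdivision operator, the linear map \<open>t^k -> t^(k+1) + k t^k\<close>;
  this is its closed form.\<close>

definition euler_shift :: "real poly \<Rightarrow> real poly" where
  "euler_shift f = monom 1 1 * f + monom 1 1 * pderiv f"

lemma euler_shift_add: "euler_shift (f + g) = euler_shift f + euler_shift g"
  by (simp add: euler_shift_def pderiv_add algebra_simps)

lemma euler_shift_smult: "euler_shift (smult c f) = smult c (euler_shift f)"
  by (simp add: euler_shift_def pderiv_smult smult_add_right)

lemma smult_sum_right:
  fixes f :: "'b \<Rightarrow> 'a::comm_semiring_0 poly"
  shows "smult c (sum f A) = (\<Sum>i\<in>A. smult c (f i))"
  by (induction A rule: infinite_finite_induct) (simp_all add: smult_add_right)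

lemma euler_shift_sum: "euler_shift (sum f A) = (\<Sum>i\<in>A. euler_shift (f i))"
  by (simp add: euler_shift_def higher_pderiv_sum[where n=1, simplified] sum_distrib_left sum.distrib)

lemma euler_shift_monom: "euler_shift (monom 1 m) = monom 1 (Suc m) + smult (real m) (monom 1 m)"
  by (cases m) (simp_all add: euler_shift_def pderiv_monom mult_monom smult_monom)

lemma euler_shift_pow_add: "(euler_shift ^^ a) (f + g) = (euler_shift ^^ a) f + (euler_shift ^^ a) g"
  by (induction a) (simp_all add: euler_shift_add)

lemma euler_shift_pow_smult: "(euler_shift ^^ a) (smult c f) = smult c ((euler_shift ^^ a) f)"
  by (induction a) (simp_all add: euler_shift_smult)

section \<open>Existence and uniqueness of the subdivision operator\<close>

lemma falling_poly_Suc: "falling_poly (Suc k) = monom 1 1 * falling_poly k - smult (real k) (falling_poly k)"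
proof -
  have *: "[:- real k, 1:] = monom 1 1 - [:real k:]"
    by (rule poly_eqI) (simp add: coeff_pCons split: nat.splits)
  have "falling_poly (Suc k) = falling_poly k * [:- real k, 1:]"
    by (simp add: falling_poly_def)
  then show ?thesis by (simp add: * algebra_simps del: pCons_one)
qed

text \<open>The operator is forced to fix \<open>1\<close> and to turn multiplication by
  \<open>t\<close> into \<open>T\<close>, so \<open>t^i\<close> must go to \<open>T^i 1\<close>, the
  \<open>i\<close>-th Touchard polynomial.\<close>

definition subdiv_explicit :: "real poly \<Rightarrow> real poly" where
  "subdiv_explicit p = (\<Sum>i\<le>degree p. smult (coeff p i) ((euler_shift ^^ i) 1))"

lemma subdiv_explicit_eq:
  assumes "degree p \<le> n"
  shows "subdiv_explicit p = (\<Sum>i\<le>n. smult (coeff p i) ((euler_shift ^^ i) 1))"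
  unfolding subdiv_explicit_def using assms
  by (intro sum.mono_neutral_left) (auto simp: coeff_eq_0)

lemma linear_smult_iff:
  fixes F :: "real poly \<Rightarrow> real poly"
  shows "Vector_Spaces.linear smult smult F \<longleftrightarrow>
    (\<forall>p q. F (p + q) = F p + F q) \<and> (\<forall>c p. F (smult c p) = smult c (F p))"
proof -
  have "vector_space (smult :: real \<Rightarrow> real poly \<Rightarrow> real poly)"
    by unfold_locales (auto simp: smult_add_right smult_add_left)
  then show ?thesis by (simp add: Vector_Spaces.linear_iff)
qed

lemma subdiv_explicit_add: "subdiv_explicit (p + q) = subdiv_explicit p + subdiv_explicit q"
proof -
  define n where "n = max (degree p) (degree q)"
  have "degree (p + q) \<le> n" "degree p \<le> n" "degree q \<le> n"
    by (auto simp: n_def degree_add_le_max)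
  then show ?thesis
    by (simp add: subdiv_explicit_eq[of _ n] sum.distrib smult_add_left)
qed

lemma subdiv_explicit_smult: "subdiv_explicit (smult c p) = smult c (subdiv_explicit p)"
  by (simp add: subdiv_explicit_eq[of _ "degree p"] degree_smult_le smult_sum_right)

lemma subdiv_explicit_linear: "Vector_Spaces.linear smult smult subdiv_explicit"
  by (simp add: linear_smult_iff subdiv_explicit_add subdiv_explicit_smult)

lemma subdiv_explicit_mult_monom: "subdiv_explicit (monom 1 1 * p) = euler_shift (subdiv_explicit p)"
proof -
  have d: "degree (monom 1 1 * p) \<le> Suc (degree p)"
    by (rule order.trans[OF degree_mult_le]) (simp add: degree_monom_eq)
  have c: "coeff (monom 1 1 * p) i = (case i of 0 \<Rightarrow> 0 | Suc j \<Rightarrow> coeff p j)" for i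
    by (simp add: coeff_monom_mult split: nat.splits)
  show ?thesis
    unfolding subdiv_explicit_eq[OF d] subdiv_explicit_def[of p] c
    by (simp add: c sum.atMost_Suc_shift euler_shift_sum euler_shift_smult del: sum.atMost_Suc)
qed

lemma subdiv_explicit_falling: "subdiv_explicit (falling_poly k) = monom 1 k"
proof (induction k)
  case 0
  then show ?case by (simp add: falling_poly_def subdiv_explicit_def monom_0)
next
  case (Suc k)
  have "subdiv_explicit (falling_poly (Suc k)) =
      subdiv_explicit (monom 1 1 * falling_poly k + smult (- real k) (falling_poly k))"
    by (simp add: falling_poly_Suc)
  also have "\<dots> = euler_shift (monom 1 k) + smult (- real k) (monom 1 k)"
    by (simp only: subdiv_explicit_add subdiv_explicit_smult subdiv_explicit_mult_monom Suc)
  finally show ?case by (simp add: euler_shift_monom)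
qed

text \<open>Stands in for the basis property of the falling factorials: agreement spreads from them
  to the monomials, and from there to all polynomials.\<close>

lemma linear_falling_unique:
  assumes "Vector_Spaces.linear smult smult F" "Vector_Spaces.linear smult smult G"
    and "\<And>k. F (falling_poly k) = G (falling_poly k)"
  shows "F = (G :: real poly \<Rightarrow> real poly)"
proof -
  have F: "F (p + q) = F p + F q" "F (smult c p) = smult c (F p)" for p q c
    using assms(1) by (auto simp: linear_smult_iff)
  have G: "G (p + q) = G p + G q" "G (smult c p) = smult c (G p)" for p q c
    using assms(2) by (auto simp: linear_smult_iff)
  \<comment> \<open>The mixed products make the induction on \<open>n\<close> close, because
    \<open>t (t)_k\<close> is a combination of \<open>(t)_(k+1)\<close> and \<open>(t)_k\<close>;
    \<open>k = 0\<close> yields the monomials.\<close>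
  have *: "F (monom 1 n * falling_poly k) = G (monom 1 n * falling_poly k)" for n k
  proof (induction n arbitrary: k)
    case 0
    then show ?case by (simp add: monom_0 assms(3))
  next
    case (Suc n)
    have m: "monom 1 (Suc n) = monom 1 n * (monom 1 1 :: real poly)"
      by (simp add: mult_monom)
    have f: "monom 1 1 * falling_poly k = falling_poly (Suc k) + smult (real k) (falling_poly k)"
      by (simp add: falling_poly_Suc)
    have "monom 1 (Suc n) * falling_poly k =
        monom 1 n * falling_poly (Suc k) + smult (real k) (monom 1 n * falling_poly k)"
      unfolding m mult.assoc f by (simp add: ring_distribs)
    then show ?case by (simp add: F G Suc)
  qed
  have m: "F (monom 1 n) = G (monom 1 n)" for n
    using *[of n 0] by (simp add: falling_poly_def)
  have 0: "F 0 = G 0" using F(2)[of 0 0] G(2)[of 0 0] by simp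
  show ?thesis
  proof
    fix p
    have "F (\<Sum>i\<le>n. monom (coeff p i) i) = G (\<Sum>i\<le>n. monom (coeff p i) i)" for n
    proof (induction n)
      case 0
      then show ?case using F(2)[of "coeff p 0" "monom 1 0"] G(2)[of "coeff p 0" "monom 1 0"] m[of 0]
        by (simp add: monom_0)
    next
      case (Suc n)
      then show ?case using F(2)[of "coeff p (Suc n)" "monom 1 (Suc n)"]
          G(2)[of "coeff p (Suc n)" "monom 1 (Suc n)"] m[of "Suc n"]
        by (simp add: smult_monom F(1) G(1))
    qed
    from this[of "degree p"] show "F p = G p" by (simp add: poly_as_sum_of_monoms)
  qed
qed

lemma subdiv_op_eq: "subdiv_op = subdiv_explicit"
  unfolding subdiv_op_def
proof (rule the_equality)
  show "Vector_Spaces.linear smult smult subdiv_explicit \<and> (\<forall>k. subdiv_explicit (falling_poly k) = monom 1 k)"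
    by (simp add: subdiv_explicit_linear subdiv_explicit_falling)
qed (auto intro: linear_falling_unique simp: subdiv_explicit_linear subdiv_explicit_falling)

section \<open>The basis polynomials: recurrences and triangularity\<close>

text \<open>For \<open>1 \<le> m \<le> N\<close> this is \<open>t R_poly (N - 1) (m - 1)\<close>.
  For \<open>m \<le> N\<close> it enumerates the stable partitions of a complete graph on
  \<open>m\<close> vertices with \<open>N - m\<close> isolated vertices added, each of which applies
  \<open>T\<close>.\<close>

definition Q_poly :: "nat \<Rightarrow> nat \<Rightarrow> real poly" where
  "Q_poly N m = (euler_shift ^^ (N - m)) (monom 1 m)"

lemma subdiv_op_Q: "subdiv_op (monom 1 a * falling_poly m) = (euler_shift ^^ a) (monom 1 m)"
proof (induction a)
  case 0
  then show ?case by (simp add: subdiv_op_eq subdiv_explicit_falling monom_0)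
next
  case (Suc a)
  have "monom 1 (Suc a) * falling_poly m = monom 1 1 * (monom 1 a * falling_poly m)"
    unfolding mult.assoc[symmetric] by (simp add: mult_monom)
  then show ?case using Suc by (simp only: subdiv_op_eq subdiv_explicit_mult_monom) simp
qed

lemma Q_poly_self [simp]: "Q_poly N N = monom 1 N"
  by (simp add: Q_poly_def)

lemma euler_shift_Q: "m \<le> N \<Longrightarrow> euler_shift (Q_poly N m) = Q_poly (Suc N) m"
  by (simp add: Q_poly_def Suc_diff_le)

text \<open>The innermost \<open>T\<close> acts by \<open>T t^m = t^(m+1) + m t^m\<close>, and the
  outer ones are linear.\<close>

lemma Q_poly_Suc_Suc:
  assumes "m \<le> N"
  shows "Q_poly (Suc N) (Suc m) = Q_poly (Suc N) m - smult (real m) (Q_poly N m)"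
proof -
  have "Q_poly (Suc N) m = (euler_shift ^^ (N - m)) (euler_shift (monom 1 m))"
    using assms by (simp add: Q_poly_def Suc_diff_le funpow_swap1)
  also have "\<dots> = Q_poly (Suc N) (Suc m) + smult (real m) (Q_poly N m)"
    by (simp add: euler_shift_monom euler_shift_pow_add euler_shift_pow_smult Q_poly_def)
  finally show ?thesis by simp
qed

lemma Q_poly_zero_one: "Q_poly (Suc N) 0 = Q_poly (Suc N) 1"
  using Q_poly_Suc_Suc[of 0 N] by simp

lemma coeff_euler_shift:
  "coeff (euler_shift f) j = (if j = 0 then 0 else coeff f (j - 1)) + real j * coeff f j"
  by (cases j) (simp_all add: euler_shift_def coeff_monom_mult coeff_pderiv)

lemma coeff_Q_poly_less: "m \<le> N \<Longrightarrow> j < m \<Longrightarrow> coeff (Q_poly N m) j = 0"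
proof (induction "N - m" arbitrary: N j)
  case 0
  then show ?case by simp
next
  case (Suc d)
  then obtain N' where N': "N = Suc N'" "m \<le> N'" by (cases N) auto
  show ?case using Suc N' by (simp add: euler_shift_Q[symmetric] coeff_euler_shift)
qed

text \<open>Nothing lies below degree \<open>m\<close>, so each \<open>T\<close> multiplies the
  coefficient in degree \<open>m\<close> by \<open>m\<close>. For \<open>m > 0\<close> it stays
  nonzero, which makes the family triangular against the monomials.\<close>

lemma coeff_Q_poly_diag: "m \<le> N \<Longrightarrow> coeff (Q_poly N m) m = real m ^ (N - m)"
proof (induction "N - m" arbitrary: N)
  case 0
  then show ?case by simp
next
  case (Suc d)
  then obtain N' where N': "N = Suc N'" "m \<le> N'" by (cases N) auto
  show ?case using Suc N'
    by (simp add: euler_shift_Q[symmetric] coeff_euler_shift coeff_Q_poly_less Suc_diff_le)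
qed

lemma R_poly_Q:
  assumes "k \<le> n"
  shows "monom 1 1 * R_poly n k = Q_poly (Suc n) (Suc k)"
proof -
  have "monom 1 1 dvd Q_poly (Suc n) (Suc k)"
    using assms coeff_Q_poly_less[of "Suc k" "Suc n"] by (auto simp: monom_1_dvd_iff')
  moreover have "R_poly n k = Q_poly (Suc n) (Suc k) div monom 1 1"
    using assms by (simp add: R_poly_def subdiv_op_Q Q_poly_def)
  ultimately show ?thesis by simp
qed

lemma coeff_R_poly: "k \<le> n \<Longrightarrow> coeff (R_poly n k) j = coeff (Q_poly (Suc n) (Suc k)) (Suc j)"
  by (simp add: R_poly_Q[symmetric] coeff_monom_mult del: One_nat_def)
     
lemma R_poly_rec:
  assumes "k < n"
  shows "R_poly n k = R_poly n (Suc k) + smult (real (Suc k)) (R_poly (n - 1) k)"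
proof -
  obtain n' where n: "n = Suc n'" using assms by (cases n) auto
  have "Q_poly (Suc n) (Suc k) = Q_poly (Suc n) (Suc (Suc k)) + smult (real (Suc k)) (Q_poly n (Suc k))"
    using Q_poly_Suc_Suc[of "Suc k" n] assms by simp
  then show ?thesis using assms by (intro poly_eqI) (simp add: coeff_R_poly n)
qed

lemma R_poly_diag: "R_poly n n = monom 1 n"
  by (rule poly_eqI) (simp add: coeff_R_poly)

text \<open>\<open>R_poly n i\<close> starts in degree \<open>i\<close> with coefficient
  \<open>(i + 1)^(n - i)\<close>, so the \<open>d i\<close> can be read off one after the other from
  below.\<close>

lemma R_poly_independent:
  assumes "(\<Sum>k\<le>n. smult (d k) (R_poly n k)) = 0" "k \<le> n"
  shows "d k = 0"
  using assms(2)
proof (induction k rule: less_induct)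
  case (less k)
  have "0 = coeff (\<Sum>k\<le>n. smult (d k) (R_poly n k)) k" by (simp add: assms)
  also have "\<dots> = (\<Sum>i\<le>n. d i * coeff (R_poly n i) k)" by (simp add: coeff_sum)
  also have "\<dots> = (\<Sum>i\<le>n. if i = k then d k * coeff (R_poly n k) k else 0)"
  proof (rule sum.cong)
    fix i assume "i \<in> {..n}"
    then show "d i * coeff (R_poly n i) k = (if i = k then d k * coeff (R_poly n k) k else 0)"
      using less by (cases i k rule: linorder_cases) (auto simp: coeff_R_poly coeff_Q_poly_less)
  qed simp
  also have "\<dots> = d k * real (Suc k) ^ (n - k)"
    using less by (simp add: coeff_R_poly coeff_Q_poly_diag)
  finally show ?case by simp
qed


section \<open>Stable partitions of chordal graphs\<close>

definition stable_partitions :: "'v set \<Rightarrow> 'v set set \<Rightarrow> 'v set set set" where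
  "stable_partitions V E = {\<pi>. partition_on V \<pi> \<and> (\<forall>B\<in>\<pi>. \<forall>e\<in>E. \<not> e \<subseteq> B)}"

text \<open>For a finite simple graph these are the coefficients of the chromatic polynomial in the
  basis of falling factorials; the polynomial is thus its image under the subdivision
  operator.\<close>

definition stable_poly :: "'v set \<Rightarrow> 'v set set \<Rightarrow> real poly" where
  "stable_poly V E = (\<Sum>\<pi>\<in>stable_partitions V E. monom 1 (card \<pi>))"

definition simple_edges :: "'v set \<Rightarrow> 'v set set \<Rightarrow> bool" where
  "simple_edges V E \<longleftrightarrow> (\<forall>e\<in>E. \<exists>a\<in>V. \<exists>b\<in>V. a \<noteq> b \<and> e = {a, b})"

definition clique :: "'v set \<Rightarrow> 'v set set \<Rightarrow> 'v set \<Rightarrow> bool" where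
  "clique V E K \<longleftrightarrow> K \<subseteq> V \<and> (\<forall>a\<in>K. \<forall>b\<in>K. a \<noteq> b \<longrightarrow> {a, b} \<in> E)"

lemma finite_stable_partitions: "finite V \<Longrightarrow> finite (stable_partitions V E)"
  by (rule finite_subset[OF _ finitely_many_partition_on]) (auto simp: stable_partitions_def)

lemma partition_on_unique_block:
  "\<lbrakk>partition_on V \<pi>; B \<in> \<pi>; C \<in> \<pi>; a \<in> B; a \<in> C\<rbrakk> \<Longrightarrow> B = C"
  by (meson disjnt_iff pairwiseD partition_on_def)

lemma partition_on_split_block:
  assumes "partition_on V \<sigma>" "v \<in> V"
  obtains C \<tau> where "\<sigma> = insert C \<tau>" "C \<notin> \<tau>" "v \<in> C" "disjnt C (\<Union>\<tau>)" "C \<subseteq> V" "partition_on (V - C) \<tau>"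
proof -
  obtain C where C: "C \<in> \<sigma>" "v \<in> C" using assms by (auto simp: partition_on_def)
  have \<sigma>: "\<sigma> = insert C (\<sigma> - {C})" using C by auto
  have d: "disjnt C (\<Union>(\<sigma> - {C}))"
    using partition_on_unique_block[OF assms(1) C(1)] by (auto simp: disjnt_iff)
  have "partition_on (V - C) (\<sigma> - {C}) \<and> C \<subseteq> V"
    using partition_on_insert[OF d, of V] assms(1) \<sigma> by simp
  then show thesis using that[of C "\<sigma> - {C}"] C d \<sigma> by auto
qed

text \<open>No edge lies inside a block, so the vertices of a clique occupy pairwise distinct
  blocks.\<close>

lemma card_blocks_meeting_clique:
  assumes \<pi>: "\<pi> \<in> stable_partitions V E" and N: "clique V E N"
  shows "card {B \<in> \<pi>. B \<inter> N \<noteq> {}} = card N"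
proof -
  have p: "partition_on V \<pi>" using \<pi> by (simp add: stable_partitions_def)
  have "\<exists>B\<in>\<pi>. a \<in> B" if "a \<in> N" for a
    using p N that by (auto simp: partition_on_def clique_def)
  then obtain f where f: "\<And>a. a \<in> N \<Longrightarrow> f a \<in> \<pi> \<and> a \<in> f a" by metis
  have "inj_on f N"
  proof (rule inj_onI)
    fix a b assume ab: "a \<in> N" "b \<in> N" "f a = f b"
    then have "{a, b} \<subseteq> f a" using f by auto
    then show "a = b" using f[OF ab(1)] \<pi> N ab(1,2)
      unfolding stable_partitions_def clique_def by blast
  qed
  moreover have "f ` N = {B \<in> \<pi>. B \<inter> N \<noteq> {}}"
    using f partition_on_unique_block[OF p] by (fastforce simp: image_iff)
  ultimately show ?thesis by (metis card_image)
qed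

text \<open>A stable partition with \<open>k\<close> blocks of the graph without \<open>v\<close>
  extends by making \<open>v\<close> a block of its own or by adding \<open>v\<close> to a block
  that avoids the neighbours \<open>N\<close>. As \<open>N\<close> is a clique, exactly
  \<open>k - card N\<close> blocks qualify, so \<open>t^k\<close> becomes
  \<open>t^(k+1) + (k - card N) t^k = (T - card N) t^k\<close>.\<close>

lemma stable_poly_simplicial:
  fixes v :: 'v and V E
  assumes fin: "finite V" and v: "v \<in> V" and E: "simple_edges V E"
    and simp: "\<And>a b. {v, a} \<in> E \<Longrightarrow> {v, b} \<in> E \<Longrightarrow> a \<noteq> b \<Longrightarrow> {a, b} \<in> E"
  defines "N \<equiv> {a. {v, a} \<in> E}" and "g \<equiv> stable_poly (V - {v}) {e \<in> E. v \<notin> e}"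
  shows "stable_poly V E = euler_shift g - smult (real (card N)) g"
    and "clique (V - {v}) {e \<in> E. v \<notin> e} N"
proof -
  let ?S = "stable_partitions (V - {v}) {e \<in> E. v \<notin> e}"
  \<comment> \<open>In a pair \<open>(\<pi>, B)\<close> the block \<open>B\<close> receives
    \<open>v\<close>; \<open>B = {}\<close> stands for the new block \<open>{v}\<close>.
    \<open>F\<close> carries out the insertion and \<open>J\<close> reverses it.\<close>
  define D where "D = Sigma ?S (\<lambda>\<pi>. insert {} {B \<in> \<pi>. B \<inter> N = {}})"
  define F where "F = (\<lambda>(\<pi>, B). insert (insert v B) (\<pi> - {B}))"
  \<comment> \<open>The block containing \<open>v\<close>, obtained as the union of the only such
    block. Removing \<open>{{}}\<close> in \<open>J\<close> handles the case that this block is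
    \<open>{v}\<close>.\<close>
  define U where "U = (\<lambda>\<sigma>. \<Union>{C \<in> \<sigma>. v \<in> C})"
  define J where "J = (\<lambda>\<sigma>. ((\<sigma> - {U \<sigma>}) \<union> ({U \<sigma> - {v}} - {{}}), U \<sigma> - {v}))"
  have vN: "v \<notin> N" using E by (auto simp: N_def simple_edges_def doubleton_eq_iff)
  have NV: "N \<subseteq> V - {v}" using E vN by (fastforce simp: N_def simple_edges_def doubleton_eq_iff)
  show clN: "clique (V - {v}) {e \<in> E. v \<notin> e} N"
    using simp NV vN unfolding clique_def by (auto simp: N_def)
  have edge_v: "\<exists>a\<in>N. e = {v, a}" if "e \<in> E" "v \<in> e" for e
  proof -
    obtain a b where ab: "e = {a, b}" using E \<open>e \<in> E\<close> by (auto simp: simple_edges_def)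
    then show ?thesis using that by (auto simp: N_def insert_commute)
  qed
  have S: "partition_on (V - {v}) \<pi>" "v \<notin> \<Union>\<pi>" "{} \<notin> \<pi>" "finite \<pi>" if "\<pi> \<in> ?S" for \<pi>
    using that fin finite_elements[of "V - {v}" \<pi>] by (auto simp: stable_partitions_def partition_on_def)
  have F_props: "F (\<pi>, B) \<in> stable_partitions V E" "J (F (\<pi>, B)) = (\<pi>, B)" 
    if D: "(\<pi>, B) \<in> D" for \<pi> B
  proof -
    have \<pi>: "\<pi> \<in> ?S" and B: "B = {} \<or> B \<in> \<pi> \<and> B \<inter> N = {}" using D by (auto simp: D_def)
    note S = S[OF \<pi>]
    have dis: "disjnt (insert v B) (\<Union>(\<pi> - {B}))"
      using B S(2) partition_on_unique_block[OF S(1)] by (auto simp: disjnt_iff)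
    have "partition_on (V - insert v B) (\<pi> - {B}) \<and> insert v B \<subseteq> V"
    proof (cases "B = {}")
      case True
      then show ?thesis using S v by simp
    next
      case False
      then have "insert B (\<pi> - {B}) = \<pi>" "disjnt B (\<Union>(\<pi> - {B}))" using B dis by (auto simp: disjnt_iff)
      then have *: "partition_on (V - {v} - B) (\<pi> - {B}) \<and> B \<subseteq> V - {v}"
        using partition_on_insert[of B "\<pi> - {B}" "V - {v}"] S(1) by simp
      have "V - {v} - B = V - insert v B" by blast
      with * show ?thesis using v by auto
    qed
    then have p: "partition_on V (F (\<pi>, B))"
      unfolding F_def prod.case partition_on_insert[OF dis] by blast
    \<comment> \<open>An edge through \<open>v\<close> ends in \<open>N\<close>, which
      \<open>B\<close> avoids; any other edge inside the enlarged block would already lie in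
      \<open>B\<close>.\<close>
    have "\<not> e \<subseteq> C" if "C \<in> F (\<pi>, B)" "e \<in> E" for C e
    proof (cases "C = insert v B")
      case True
      show ?thesis
      proof (cases "v \<in> e")
        case True
        then show ?thesis using edge_v[OF \<open>e \<in> E\<close>] B vN \<open>C = insert v B\<close> by auto
      next
        case False
        have "\<not> e \<subseteq> B" 
        proof (cases "B = {}")
          case True
          then show ?thesis using E \<open>e \<in> E\<close> by (auto simp: simple_edges_def)
        next
          case F: False
          then show ?thesis using B \<pi> False \<open>e \<in> E\<close> by (auto simp: stable_partitions_def)
        qed
        then show ?thesis using False True by auto
      qed
    next
      case False
      then have "C \<in> \<pi>" using that by (auto simp: F_def)
      then show ?thesis using \<pi> S(2) \<open>e \<in> E\<close> unfolding stable_partitions_def by blast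
    qed
    then show "F (\<pi>, B) \<in> stable_partitions V E" using p by (auto simp: stable_partitions_def)
    have "{C \<in> F (\<pi>, B). v \<in> C} = {insert v B}" using S(2) by (auto simp: F_def)
    then have U: "U (F (\<pi>, B)) = insert v B" by (simp add: U_def)
    have vB: "v \<notin> B" using B S(2) by auto
    have "F (\<pi>, B) - {insert v B} = \<pi> - {B}" using S(2) by (auto simp: F_def)
    then have "J (F (\<pi>, B)) = ((\<pi> - {B}) \<union> ({B} - {{}}), B)" using vB by (simp add: J_def U)
    then show "J (F (\<pi>, B)) = (\<pi>, B)" using B S(3) by auto
  qed
  have J_props: "J \<sigma> \<in> D \<and> F (J \<sigma>) = \<sigma>" if \<sigma>: "\<sigma> \<in> stable_partitions V E" for \<sigma>
  proof -
    have p\<sigma>: "partition_on V \<sigma>" using \<sigma> by (simp add: stable_partitions_def)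
    obtain C \<tau> where C: "\<sigma> = insert C \<tau>" "C \<notin> \<tau>" "v \<in> C" "disjnt C (\<Union>\<tau>)" "C \<subseteq> V" "partition_on (V - C) \<tau>"
      using partition_on_split_block[OF p\<sigma> v] .
    have "{C \<in> \<sigma>. v \<in> C} = {C}" using C by (auto simp: disjnt_iff)
    then have U: "U \<sigma> = C" by (simp add: U_def)
    define B where "B = C - {v}"
    have CB: "C = insert v B" "v \<notin> B" using C by (auto simp: B_def)
    have "\<sigma> - {C} = \<tau>" using C(1,2) by auto
    then have J: "J \<sigma> = (\<tau> \<union> ({B} - {{}}), B)" by (simp add: J_def U B_def)
    have e\<tau>: "{} \<notin> \<tau>" using C(6) by (simp add: partition_on_def)
    have stC: "\<And>e. e \<in> E \<Longrightarrow> \<not> e \<subseteq> C" and st\<tau>: "\<And>e K. e \<in> E \<Longrightarrow> K \<in> \<tau> \<Longrightarrow> \<not> e \<subseteq> K"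
      using \<sigma> C(1) by (auto simp: stable_partitions_def)
    have BN: "B \<inter> N = {}" using stC CB by (auto simp: N_def)
    show ?thesis
    proof (cases "B = {}")
      case True
      then have "\<tau> \<in> ?S" using C(6) CB st\<tau> by (auto simp: stable_partitions_def)
      then show ?thesis using True J e\<tau> C CB by (simp add: D_def F_def)
    next
      case False
      have B\<tau>: "B \<notin> \<tau>" using False C(4) CB(1) by (auto simp: disjnt_iff)
      have dis: "disjnt B (\<Union>\<tau>)" using C(4) CB(1) by (auto simp: disjnt_iff)
      have "partition_on (V - {v}) (insert B \<tau>)"
        unfolding partition_on_insert[OF dis] using False C(5,6) CB by (auto simp: Diff_insert2[symmetric])
      then have "insert B \<tau> \<in> ?S" using st\<tau> stC CB(1) by (auto simp: stable_partitions_def)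
      then show ?thesis using False J B\<tau> BN C CB by (simp add: D_def F_def)
    qed
  qed
  have "stable_poly V E = (\<Sum>x\<in>D. monom 1 (card (F x)))"
    unfolding stable_poly_def
    by (rule sum.reindex_bij_witness[where i = F and j = J]) (use F_props J_props in auto)
  also have "\<dots> = (\<Sum>\<pi>\<in>?S. \<Sum>B\<in>insert {} {B \<in> \<pi>. B \<inter> N = {}}. monom 1 (card (F (\<pi>, B))))"
    unfolding D_def using fin S(4)
    by (subst sum.Sigma) (auto simp: finite_stable_partitions)
  also have "\<dots> = (\<Sum>\<pi>\<in>?S. euler_shift (monom 1 (card \<pi>)) - smult (real (card N)) (monom 1 (card \<pi>)))"
  proof (rule sum.cong[OF refl])
    fix \<pi> assume \<pi>: "\<pi> \<in> ?S"
    note S = S[OF \<pi>]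
    have v': "insert v B \<notin> \<pi>" for B using S(2) by auto
    have 1: "card (F (\<pi>, {})) = Suc (card \<pi>)" using S v' by (simp add: F_def)
    have 2: "card (F (\<pi>, B)) = card \<pi>" if "B \<in> \<pi>" for B
      using that S(4) v' card_Suc_Diff1[OF S(4) that] by (simp add: F_def del: card_Diff_insert)
    have "card \<pi> = card {B \<in> \<pi>. B \<inter> N = {}} + card {B \<in> \<pi>. B \<inter> N \<noteq> {}}"
      using S(4) by (subst card_Un_disjoint[symmetric]) (auto intro: arg_cong[where f = card])
    then have 3: "real (card {B \<in> \<pi>. B \<inter> N = {}}) = real (card \<pi>) - real (card N)"
      using card_blocks_meeting_clique[OF \<pi> clN] by simp
    have "(\<Sum>B\<in>insert {} {B \<in> \<pi>. B \<inter> N = {}}. monom 1 (card (F (\<pi>, B)))) =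
        monom 1 (Suc (card \<pi>)) + (\<Sum>B\<in>{B \<in> \<pi>. B \<inter> N = {}}. monom 1 (card \<pi>) :: real poly)"
      using S by (subst sum.insert) (auto simp: 1 2)
    also have "(\<Sum>B\<in>{B \<in> \<pi>. B \<inter> N = {}}. monom 1 (card \<pi>)) =
        smult (real (card \<pi>) - real (card N)) (monom 1 (card \<pi>) :: real poly)"
      by (simp add: 3[symmetric] of_nat_poly smult_monom)
    finally show "(\<Sum>B\<in>insert {} {B \<in> \<pi>. B \<inter> N = {}}. monom 1 (card (F (\<pi>, B)))) =
        euler_shift (monom 1 (card \<pi>)) - smult (real (card N)) (monom 1 (card \<pi>))"
      by (simp add: euler_shift_monom smult_diff_left)
  qed
  also have "\<dots> = euler_shift g - smult (real (card N)) g"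
    by (simp add: g_def stable_poly_def euler_shift_sum smult_sum_right sum_subtractf)
  finally show "stable_poly V E = euler_shift g - smult (real (card N)) g" .
qed

section \<open>Nonnegative cones and simplicial elimination\<close>

text \<open>The lower bound \<open>w\<close> on the indices is what keeps \<open>T - d\<close> from
  producing negative coefficients when \<open>d \<le> w\<close>.\<close>

definition Q_cone :: "nat \<Rightarrow> nat \<Rightarrow> real poly set" where
  "Q_cone N w = {f. \<exists>c. (\<forall>m. 0 \<le> c m) \<and> f = (\<Sum>m\<in>{w..N}. smult (c m) (Q_poly N m))}"

lemma Q_cone_add: "f \<in> Q_cone N w \<Longrightarrow> g \<in> Q_cone N w \<Longrightarrow> f + g \<in> Q_cone N w"
proof -
  assume "f \<in> Q_cone N w" "g \<in> Q_cone N w"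
  then obtain c d where "\<forall>m. 0 \<le> c m" "f = (\<Sum>m\<in>{w..N}. smult (c m) (Q_poly N m))"
    "\<forall>m. 0 \<le> d m" "g = (\<Sum>m\<in>{w..N}. smult (d m) (Q_poly N m))" by (auto simp: Q_cone_def)
  then show ?thesis unfolding Q_cone_def
    by (intro CollectI exI[of _ "\<lambda>m. c m + d m"]) (simp add: smult_add_left sum.distrib)
qed

lemma Q_cone_smult: "f \<in> Q_cone N w \<Longrightarrow> 0 \<le> a \<Longrightarrow> smult a f \<in> Q_cone N w"
proof -
  assume "f \<in> Q_cone N w" "0 \<le> a"
  then obtain c where "\<forall>m. 0 \<le> c m" "f = (\<Sum>m\<in>{w..N}. smult (c m) (Q_poly N m))"
    by (auto simp: Q_cone_def)
  with \<open>0 \<le> a\<close> show ?thesis unfolding Q_cone_def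
    by (intro CollectI exI[of _ "\<lambda>m. a * c m"]) (simp add: smult_sum_right)
qed

lemma Q_cone_base: "w \<le> m \<Longrightarrow> m \<le> N \<Longrightarrow> Q_poly N m \<in> Q_cone N w"
  unfolding Q_cone_def
  by (intro CollectI exI[of _ "\<lambda>k. if k = m then 1 else 0"]) (simp add: if_distrib[of "\<lambda>x. smult x _"] cong: if_cong)

lemma Q_cone_zero: "0 \<in> Q_cone N w"
  unfolding Q_cone_def by (intro CollectI exI[of _ "\<lambda>k. 0"]) simp

lemma Q_cone_sum: "(\<And>i. i \<in> I \<Longrightarrow> f i \<in> Q_cone N w) \<Longrightarrow> sum f I \<in> Q_cone N w"
  by (induction I rule: infinite_finite_induct) (auto simp: Q_cone_zero Q_cone_add)

lemma Q_cone_mono: "f \<in> Q_cone N w \<Longrightarrow> w' \<le> w \<Longrightarrow> f \<in> Q_cone N w'"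
proof -
  assume "f \<in> Q_cone N w" "w' \<le> w"
  then obtain c where c: "\<And>m. 0 \<le> c m" and f: "f = (\<Sum>m\<in>{w..N}. smult (c m) (Q_poly N m))"
    by (auto simp: Q_cone_def)
  show ?thesis unfolding f
    using c \<open>w' \<le> w\<close> by (auto intro!: Q_cone_sum Q_cone_smult Q_cone_base)
qed

text \<open>\<open>(T - d) Q_poly N m\<close> is the convex combination of \<open>Q_poly (N + 1) m\<close> and
  \<open>Q_poly (N + 1) (m + 1)\<close> with weight \<open>d / m\<close> on the latter.\<close>

lemma Q_cone_step:
  assumes "f \<in> Q_cone N w" "d \<le> w"
  shows "euler_shift f - smult (real d) f \<in> Q_cone (Suc N) (max w (Suc d))"
proof -
  obtain c where c: "\<And>m. 0 \<le> c m" and f: "f = (\<Sum>m\<in>{w..N}. smult (c m) (Q_poly N m))"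
    using assms by (auto simp: Q_cone_def)
  have step: "euler_shift (Q_poly N m) - smult (real d) (Q_poly N m) \<in> Q_cone (Suc N) (max w (Suc d))"
    if m: "w \<le> m" "m \<le> N" for m
  \<comment> \<open>For \<open>m = d\<close> the index \<open>m\<close> falls below the new bound
    \<open>Suc d\<close>, so the polynomial of index \<open>m\<close> must drop out entirely; this
    also covers \<open>d = m = 0\<close>, where \<open>d / m\<close> is no weight.\<close>
  proof (cases "m = d")
    case True
    then have "euler_shift (Q_poly N m) - smult (real d) (Q_poly N m) = Q_poly (Suc N) (Suc m)"
      using m by (simp add: euler_shift_Q Q_poly_Suc_Suc)
    then show ?thesis using m True by (auto intro!: Q_cone_base)
  next
    case False
    then have dm: "d < m" using assms m by simp
    define l where "l = real d / real m"
    have l: "0 \<le> l" "l \<le> 1" "l * real m = real d" using dm by (auto simp: l_def)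
    have "euler_shift (Q_poly N m) - smult (real d) (Q_poly N m) =
        smult (1 - l) (Q_poly (Suc N) m) + smult l (Q_poly (Suc N) (Suc m))"
      using m by (simp add: euler_shift_Q Q_poly_Suc_Suc smult_diff_right smult_diff_left l)
    then show ?thesis using m dm l by (auto intro!: Q_cone_add Q_cone_smult Q_cone_base)
  qed
  have "euler_shift f - smult (real d) f =
      (\<Sum>m\<in>{w..N}. smult (c m) (euler_shift (Q_poly N m) - smult (real d) (Q_poly N m)))"
    by (simp add: f euler_shift_sum euler_shift_smult smult_sum_right sum_subtractf smult_diff_right mult.commute)
  also have "\<dots> \<in> Q_cone (Suc N) (max w (Suc d))"
    using c step by (auto intro!: Q_cone_sum Q_cone_smult)
  finally show ?thesis .
qed

lemma stable_poly_empty: "stable_poly {} {} = Q_poly 0 0"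
  by (simp add: stable_poly_def stable_partitions_def partition_on_empty monom_0 cong: conj_cong)

text \<open>Induction along the elimination order. Since \<open>w\<close> also bounds all clique
  sizes, the neighbourhood of the vertex to be attached, a clique, has size at most
  \<open>w\<close>, as \<open>Q_cone_step\<close> demands.\<close>

lemma chordal_stable_poly:
  assumes "chordal V E" "simple_edges V E"
  shows "finite V \<and> (\<exists>w. stable_poly V E \<in> Q_cone (card V) w \<and> (\<forall>K. clique V E K \<longrightarrow> card K \<le> w))"
  using assms
proof (induction)
  case empty
  show ?case using Q_cone_base[of 0 0 0]
    by (auto intro!: exI[of _ 0] simp: clique_def stable_poly_empty simp del: Q_poly_self)
next
  case (simplicial v V E)
  let ?V = "V - {v}" and ?E = "{e \<in> E. v \<notin> e}"
  have "simple_edges ?V ?E" using simplicial.prems by (fastforce simp: simple_edges_def)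
  with simplicial.IH obtain w where fin: "finite ?V" and w: "stable_poly ?V ?E \<in> Q_cone (card ?V) w"
    "\<And>K. clique ?V ?E K \<Longrightarrow> card K \<le> w" by auto
  have finV: "finite V" using fin by simp
  let ?N = "{a. {v, a} \<in> E}"
  note sp = stable_poly_simplicial[OF finV simplicial.hyps(1) simplicial.prems simplicial.hyps(2), simplified]
  have N: "card ?N \<le> w" using w(2)[OF sp(2)] .
  have cV: "card V = Suc (card ?V)" using card_Suc_Diff1[OF finV simplicial.hyps(1)] by (rule sym)
  have "stable_poly V E \<in> Q_cone (card V) (max w (Suc (card ?N)))"
    unfolding sp(1) cV by (rule Q_cone_step[OF w(1) N])
  \<comment> \<open>A clique through \<open>v\<close> consists of \<open>v\<close> and neighbours of
    \<open>v\<close>; any other clique was there before \<open>v\<close> was attached.\<close>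
  moreover have "card K \<le> max w (Suc (card ?N))" if K: "clique V E K" for K
  proof (cases "v \<in> K")
    case True
    have finN: "finite ?N" using sp(2) fin finite_subset by (auto simp: clique_def)
    have "K - {v} \<subseteq> ?N" using K True by (auto simp: clique_def)
    then have "card (K - {v}) \<le> card ?N" by (rule card_mono[OF finN])
    moreover have "finite K" using K finV finite_subset by (auto simp: clique_def)
    ultimately show ?thesis using True by (simp add: card_Diff_singleton)
  next
    case False
    then have "clique ?V ?E K" using K by (auto simp: clique_def)
    then show ?thesis using w(2) by fastforce
  qed
  ultimately show ?case using finV by blast
qed

text \<open>Serves the first facet of a shelling, whose whole ideal is new.\<close>

lemma chordal_empty_edges: "finite V \<Longrightarrow> chordal V {}"
proof (induction V rule: finite_induct)
  case empty
  then show ?case by (rule chordal.empty)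
next
  case (insert x F)
  then have "chordal (insert x F - {x}) {e \<in> {}. x \<notin> e}" by simp
  then show ?case by (rule chordal.simplicial[rotated 2]) simp_all
qed

text \<open>A single vertex is a clique, so \<open>w \<ge> 1\<close>, and the polynomials
  \<open>Q_poly (Suc n) m\<close> with \<open>m \<ge> 1\<close> are \<open>t\<close> times the
  \<open>R_poly n (m - 1)\<close>.\<close>

lemma chordal_stable_poly_R:
  assumes "chordal V E" "simple_edges V E" "card V = Suc n"
  shows "\<exists>h. (\<forall>k. 0 \<le> h k) \<and> stable_poly V E = monom 1 1 * (\<Sum>k\<le>n. smult (h k) (R_poly n k))"
proof -
  obtain w where w: "stable_poly V E \<in> Q_cone (card V) w" "\<And>K. clique V E K \<Longrightarrow> card K \<le> w"
    using chordal_stable_poly[OF assms(1,2)] by auto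
  obtain v where "v \<in> V" using assms(3) by fastforce
  then have "1 \<le> w" using w(2)[of "{v}"] by (simp add: clique_def)
  then have "stable_poly V E \<in> Q_cone (Suc n) 1" using Q_cone_mono w(1) assms(3) by metis
  then obtain c where c: "\<And>m. 0 \<le> c m" "stable_poly V E = (\<Sum>m\<in>{1..Suc n}. smult (c m) (Q_poly (Suc n) m))"
    by (auto simp: Q_cone_def)
  have "{1..Suc n} = Suc ` {..n}" by (simp add: image_Suc_atMost)
  then have "stable_poly V E = (\<Sum>k\<le>n. smult (c (Suc k)) (Q_poly (Suc n) (Suc k)))"
    unfolding c(2) by (simp add: sum.reindex)
  also have "\<dots> = monom 1 1 * (\<Sum>k\<le>n. smult (c (Suc k)) (R_poly n k))"
    by (simp add: sum_distrib_left R_poly_Q[symmetric] del: One_nat_def)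
  finally show ?thesis using c(1) by (intro exI[of _ "\<lambda>k. c (Suc k)"] conjI allI)
qed


section \<open>Ranks in partition posets\<close>

text \<open>Sending a block of \<open>P\<close> to the block of \<open>Q\<close> around it is a
  surjection. If the counts agree it is injective, so every block of \<open>Q\<close>, being a union
  of blocks of \<open>P\<close>, is a single one of them.\<close>

lemma refines_card:
  assumes "refines A P Q" "finite A"
  shows "card Q \<le> card P" and "card Q = card P \<Longrightarrow> P = Q"
proof -
  have p: "partition_on A P" "partition_on A Q" using assms(1) by (auto simp: refines_def)
  then have fin: "finite P" "finite Q" using assms(2) finite_elements by blast+
  obtain f where f: "\<And>X. X \<in> P \<Longrightarrow> f X \<in> Q \<and> X \<subseteq> f X"
    using assms(1) unfolding refines_def by metis
  have fI: "f X = Y" if XY: "X \<in> P" "Y \<in> Q" "X \<subseteq> Y" for X Y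
  proof -
    have "X \<noteq> {}" using p(1) XY(1) by (auto simp: partition_on_def)
    then obtain a where "a \<in> X" by blast
    then show ?thesis using f[OF XY(1)] XY partition_on_unique_block[OF p(2), of "f X" Y a] by auto
  qed
  have sub: "Y = \<Union>{X \<in> P. X \<subseteq> Y}" if "Y \<in> Q" for Y
    using refines_obtains_subset[OF assms(1) that] by (simp add: partition_on_def)
  have "\<exists>X\<in>P. X \<subseteq> Y" if "Y \<in> Q" for Y
  proof -
    have "Y \<noteq> {}" using p(2) that by (auto simp: partition_on_def)
    then obtain y where "y \<in> Y" by blast
    then have "y \<in> \<Union>{X \<in> P. X \<subseteq> Y}" using sub[OF that] by blast
    then show ?thesis by blast
  qed
  then have im: "f ` P = Q" using f fI by (force simp: image_iff)
  then show "card Q \<le> card P" using card_image_le[OF fin(1), of f] by simp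
  assume "card Q = card P"
  then have inj: "inj_on f P" using im fin by (simp add: eq_card_imp_inj_on)
  have "f X = X" if X: "X \<in> P" for X
  proof -
    have "X' = X" if "X' \<in> P" "X' \<subseteq> f X" for X'
      using inj_onD[OF inj fI[of X' "f X"]] that f[OF X] X by blast
    then have "{X' \<in> P. X' \<subseteq> f X} = {X}" using f[OF X] X by blast
    then have "\<Union>{X' \<in> P. X' \<subseteq> f X} = X" by simp
    with sub[of "f X"] f[OF X] show ?thesis by argo
  qed
  then show "P = Q" using im by force
qed

text \<open>Two blocks are merged; repeated, this builds long chains below a partition.\<close>

lemma refines_merge:
  assumes "partition_on A \<sigma>" "finite A" "2 \<le> card \<sigma>"
  obtains \<pi> where "refines A \<sigma> \<pi>" "card \<sigma> = Suc (card \<pi>)"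
proof -
  have fin: "finite \<sigma>" using assms finite_elements by blast
  obtain B where B: "B \<in> \<sigma>" using assms(3) by fastforce
  have "1 \<le> card (\<sigma> - {B})" using assms(3) B fin by (simp add: card_Diff_singleton)
  then obtain C where C: "C \<in> \<sigma>" "C \<noteq> B" by (metis Diff_iff One_nat_def card.empty ex_in_conv not_one_le_zero singletonI)
  define \<rho> where "\<rho> = \<sigma> - {B, C}"
  have \<sigma>: "\<sigma> = insert B (insert C \<rho>)" using B C by (auto simp: \<rho>_def)
  have neq: "B \<noteq> C" "B \<notin> \<rho>" "C \<notin> \<rho>" using C by (auto simp: \<rho>_def)
  have dis: "disjnt X Y" if "X \<in> \<sigma>" "Y \<in> \<sigma>" "X \<noteq> Y" for X Y
    using assms(1) that by (auto simp: partition_on_def pairwise_def)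
  have d: "disjnt (B \<union> C) (\<Union>\<rho>)"
    using dis \<sigma> neq by (auto simp: disjnt_Un1)
  have ne: "B \<noteq> {}" using assms(1) B by (auto simp: partition_on_def)
  have nm: "B \<union> C \<notin> \<rho>" using d ne by (auto simp: disjnt_iff)
  have dB: "disjnt B (\<Union>(insert C \<rho>))" "disjnt C (\<Union>\<rho>)" using dis \<sigma> neq by auto
  have "partition_on (A - B - C) \<rho> \<and> B \<subseteq> A \<and> C \<subseteq> A"
    using assms(1) unfolding \<sigma> partition_on_insert[OF dB(1)] partition_on_insert[OF dB(2)] by blast
  moreover have "A - B - C = A - (B \<union> C)" by blast
  ultimately have "partition_on A (insert (B \<union> C) \<rho>)"
    using partition_on_insert[OF d, of A] ne by simp
  then have "refines A \<sigma> (insert (B \<union> C) \<rho>)"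
    using assms(1) by (auto simp: refines_def \<sigma>)
  moreover have "card \<sigma> = Suc (card (insert (B \<union> C) \<rho>))"
    using neq nm fin by (simp add: \<sigma>)
  ultimately show thesis using that by blast
qed

section \<open>Heights as an isomorphism invariant\<close>

text \<open>Heights depend on the order alone and so show that ranks are well defined. They count
  the elements of chains, hence exceed ranks by one.\<close>

definition is_height :: "'a set \<Rightarrow> 'a rel \<Rightarrow> 'a \<Rightarrow> nat \<Rightarrow> bool" where
  "is_height P r x h \<longleftrightarrow>
     (\<exists>C. poset_chain P r C \<and> C \<subseteq> principal_ideal P r x \<and> card C = h) \<and>
     (\<forall>C. poset_chain P r C \<and> C \<subseteq> principal_ideal P r x \<longrightarrow> card C \<le> h)"

lemma is_height_unique: "is_height P r x h \<Longrightarrow> is_height P r x h' \<Longrightarrow> h = h'"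
  unfolding is_height_def by (meson le_antisym)

lemma poset_chain_iff:
  "poset_chain P r C \<longleftrightarrow> C \<subseteq> P \<and> (\<forall>x\<in>C. \<forall>y\<in>C. x = y \<or> (x, y) \<in> r \<or> (y, x) \<in> r)"
  unfolding pred_on.chain_def by auto

text \<open>Merging blocks one at a time leads from \<open>\<sigma>\<close> down to the one-block
  partition, through one partition for each block count.\<close>

lemma dual_partitions_height_exists:
  assumes "\<sigma> \<in> dual_partitions n"
  shows "\<exists>C. poset_chain (dual_partitions n) (dual_partition_order n) C \<and>
    C \<subseteq> principal_ideal (dual_partitions n) (dual_partition_order n) \<sigma> \<and> card C = card \<sigma>"
  using assms
proof (induction "card \<sigma>" arbitrary: \<sigma> rule: less_induct)
  case less
  let ?D = "dual_partitions n" and ?O = "dual_partition_order n"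
  have p: "partition_on {1..n+1} \<sigma>" using less.prems by (simp add: dual_partitions_def)
  then have fin: "finite \<sigma>" using finite_elements by blast
  have "\<sigma> \<noteq> {}" using p by (auto simp: partition_on_def)
  show ?case
  proof (cases "2 \<le> card \<sigma>")
    case False
    then have "card \<sigma> = 1" using fin \<open>\<sigma> \<noteq> {}\<close> by (simp add: Suc_le_eq less_2_cases_iff not_le)
    then show ?thesis using less.prems p unfolding poset_chain_iff
      by (intro exI[of _ "{\<sigma>}"])
        (auto simp: principal_ideal_def dual_partition_order_def refines_refl)
  next
    case True
    obtain \<pi> where \<pi>: "refines {1..n+1} \<sigma> \<pi>" "card \<sigma> = Suc (card \<pi>)"
      using refines_merge[OF p _ True] by blast
    then have D: "\<pi> \<in> ?D" by (auto simp: refines_def dual_partitions_def)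
    obtain C where C: "poset_chain ?D ?O C" "C \<subseteq> principal_ideal ?D ?O \<pi>" "card C = card \<pi>"
      using less.hyps[OF _ D] \<pi>(2) by auto
    have le: "(c, \<sigma>) \<in> ?O" if "c \<in> C" for c
      using C(2) that \<pi>(1) by (auto simp: principal_ideal_def dual_partition_order_def intro: refines_trans)
    have "\<sigma> \<notin> C"
    proof
      assume "\<sigma> \<in> C"
      then have "refines {1..n+1} \<pi> \<sigma>" using C(2) by (auto simp: principal_ideal_def dual_partition_order_def)
      then show False using refines_card(1)[of "{1..n+1}" \<pi> \<sigma>] \<pi>(2) by simp
    qed
    moreover have "finite C"
      by (rule finite_subset[of _ ?D]) (use C(1) finitely_many_partition_on in \<open>auto simp: poset_chain_iff dual_partitions_def\<close>)
    moreover have "poset_chain ?D ?O (insert \<sigma> C)"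
      using C(1) le less.prems by (auto simp: poset_chain_iff)
    moreover have "insert \<sigma> C \<subseteq> principal_ideal ?D ?O \<sigma>"
      using C(1) le less.prems refines_refl[OF p]
      unfolding poset_chain_iff by (auto simp: principal_ideal_def dual_partition_order_def)
    ultimately show ?thesis using C(3) \<pi>(2) by (intro exI[of _ "insert \<sigma> C"]) auto
  qed
qed

text \<open>Along a chain of partitions the number of blocks is strictly monotone, with values
  between \<open>1\<close> and \<open>card \<sigma>\<close>.\<close>

lemma dual_partitions_height:
  assumes "\<sigma> \<in> dual_partitions n"
  shows "is_height (dual_partitions n) (dual_partition_order n) \<sigma> (card \<sigma>)"
proof -
  let ?D = "dual_partitions n" and ?O = "dual_partition_order n"
  have "card C \<le> card \<sigma>" if C: "poset_chain ?D ?O C" "C \<subseteq> principal_ideal ?D ?O \<sigma>" for C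
  proof -
    have "inj_on card C"
    proof (rule inj_onI)
      fix \<pi> \<tau> assume "\<pi> \<in> C" "\<tau> \<in> C" and eq: "card \<pi> = card \<tau>"
      then have "\<pi> = \<tau> \<or> (\<pi>, \<tau>) \<in> ?O \<or> (\<tau>, \<pi>) \<in> ?O"
        using C(1) unfolding poset_chain_iff by blast
      then consider "\<pi> = \<tau>" | "refines {1..n+1} \<tau> \<pi>" | "refines {1..n+1} \<pi> \<tau>"
        by (auto simp: dual_partition_order_def)
      then show "\<pi> = \<tau>" using refines_card(2)[of "{1..n+1}"] eq by cases auto
    qed
    moreover have "card ` C \<subseteq> {1..card \<sigma>}"
    proof clarify
      fix \<pi> assume "\<pi> \<in> C"
      then have r: "refines {1..n+1} \<sigma> \<pi>" using C(2) by (auto simp: principal_ideal_def dual_partition_order_def)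
      then have p: "partition_on {1..n+1} \<pi>" by (simp add: refines_def)
      then have "\<pi> \<noteq> {}" "finite \<pi>" using finite_elements[of "{1..n+1}" \<pi>] by (auto simp: partition_on_def)
      then show "card \<pi> \<in> {1..card \<sigma>}" using refines_card(1)[OF r] by (simp add: Suc_le_eq card_gt_0_iff)
    qed
    ultimately show ?thesis using card_inj_on_le[of card C "{1..card \<sigma>}"] by simp
  qed
  then show ?thesis using dual_partitions_height_exists[OF assms] by (auto simp: is_height_def)
qed

lemma card_singletons: "card ((\<lambda>c. {c}) ` A) = card A"
  by (simp add: card_image)

lemma singletons_refine: "partition_on A \<pi> \<Longrightarrow> refines A ((\<lambda>c. {c}) ` A) \<pi>"
  unfolding refines_def using partition_on_singletons[of A] by (auto simp: partition_on_def)

section \<open>Ranks in an abstract partition poset\<close>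

locale partition_pos =
  fixes P :: "'a set" and r :: "'a rel"
  assumes partition_poset: "partition_poset P r"
begin

abbreviation ideal :: "'a \<Rightarrow> 'a set" where "ideal \<equiv> principal_ideal P r"
abbreviation rk :: "'a \<Rightarrow> nat" where "rk \<equiv> rank_of P r"

lemma fin: "finite P"
  using partition_poset by (simp add: partition_poset_def)

lemma order_refl: "x \<in> P \<Longrightarrow> (x, x) \<in> r"
  and order_trans: "(x, y) \<in> r \<Longrightarrow> (y, z) \<in> r \<Longrightarrow> (x, z) \<in> r"
  and order_antisym: "(x, y) \<in> r \<Longrightarrow> (y, x) \<in> r \<Longrightarrow> x = y"
  and order_carrier: "(x, y) \<in> r \<Longrightarrow> x \<in> P \<and> y \<in> P"
proof -
  have "refl_on P r" "trans r" "antisym r" "r \<subseteq> P \<times> P"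
    using partition_poset by (auto simp: partition_poset_def partial_order_on_def preorder_on_def)
  then show "x \<in> P \<Longrightarrow> (x, x) \<in> r" "(x, y) \<in> r \<Longrightarrow> (y, z) \<in> r \<Longrightarrow> (x, z) \<in> r"
    "(x, y) \<in> r \<Longrightarrow> (y, x) \<in> r \<Longrightarrow> x = y" "(x, y) \<in> r \<Longrightarrow> x \<in> P \<and> y \<in> P"
    by (blast dest: refl_onD, blast dest: transD, blast dest: antisymD, blast)
qed

lemma mem_ideal: "z \<in> ideal x \<longleftrightarrow> (z, x) \<in> r"
  using order_carrier by (auto simp: principal_ideal_def)

lemma ideal_mono: "(z, x) \<in> r \<Longrightarrow> ideal z \<subseteq> ideal x"
  using order_trans by (auto simp: mem_ideal)

lemma iso_props:
  assumes "dual_partition_iso (ideal x) r n \<phi>"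
  shows "inj_on \<phi> (ideal x)" and "\<phi> ` ideal x = dual_partitions n"
    and "\<And>a b. (a, x) \<in> r \<Longrightarrow> (b, x) \<in> r \<Longrightarrow> (a, b) \<in> r \<longleftrightarrow> (\<phi> a, \<phi> b) \<in> dual_partition_order n"
proof -
  have bij: "bij_betw \<phi> (ideal x) (dual_partitions n)"
    and ord: "\<forall>a\<in>ideal x. \<forall>b\<in>ideal x. (a, b) \<in> r \<longleftrightarrow> (\<phi> a, \<phi> b) \<in> dual_partition_order n"
    using assms unfolding dual_partition_iso_def poset_iso_def by (rule conjunct1, rule conjunct2)
  show "inj_on \<phi> (ideal x)" "\<phi> ` ideal x = dual_partitions n"
    using bij by (simp_all add: bij_betw_def)
  fix a b assume "(a, x) \<in> r" "(b, x) \<in> r"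
  then have "a \<in> ideal x" "b \<in> ideal x" by (simp_all add: mem_ideal)
  then show "(a, b) \<in> r \<longleftrightarrow> (\<phi> a, \<phi> b) \<in> dual_partition_order n"
    by (rule ord[rule_format])
qed

text \<open>Chains below \<open>z\<close> lie in the ideal of \<open>x\<close>, so
  \<open>\<phi>\<close> and its inverse carry them to chains of equal size below
  \<open>\<phi> z\<close> and back.\<close>

lemma iso_height:
  assumes \<phi>: "dual_partition_iso (ideal x) r n \<phi>" and z: "(z, x) \<in> r"
  shows "is_height P r z (card (\<phi> z))"
proof -
  let ?D = "dual_partitions n" and ?O = "dual_partition_order n"
  note inj = iso_props(1)[OF \<phi>] and im = iso_props(2)[OF \<phi>] and ord = iso_props(3)[OF \<phi>]
  have "\<phi> z \<in> ?D" using z im by (auto simp: mem_ideal)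
  note h = dual_partitions_height[OF this]
  have sub: "ideal z \<subseteq> ideal x" using ideal_mono[OF z] .
  show ?thesis unfolding is_height_def
  proof (intro conjI allI impI)
    obtain C where C: "poset_chain ?D ?O C" "C \<subseteq> principal_ideal ?D ?O (\<phi> z)" "card C = card (\<phi> z)"
      using h by (auto simp: is_height_def)
    define B where "B = {b \<in> ideal x. \<phi> b \<in> C}"
    have "C \<subseteq> \<phi> ` ideal x" using C(1) im by (auto simp: poset_chain_iff)
    then have "\<phi> ` B = C" by (auto simp: B_def)
    moreover have injB: "inj_on \<phi> B" using inj by (rule inj_on_subset) (auto simp: B_def)
    ultimately have "card B = card (\<phi> z)" using C(3) card_image by metis
    moreover have "B \<subseteq> ideal z"
    proof
      fix b assume "b \<in> B"
      then have "(b, x) \<in> r" "(\<phi> b, \<phi> z) \<in> ?O"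
        using C(2) by (auto simp: B_def mem_ideal principal_ideal_def)
      then show "b \<in> ideal z" using ord z unfolding mem_ideal by blast
    qed
    moreover have "poset_chain P r B"
      unfolding poset_chain_iff
    proof (intro conjI ballI)
      show "B \<subseteq> P" by (auto simp: B_def principal_ideal_def)
      fix a b assume ab: "a \<in> B" "b \<in> B"
      then have "\<phi> a = \<phi> b \<or> (\<phi> a, \<phi> b) \<in> ?O \<or> (\<phi> b, \<phi> a) \<in> ?O"
        using C(1) unfolding poset_chain_iff B_def by blast
      moreover have "(a, x) \<in> r" "(b, x) \<in> r" using ab by (auto simp: B_def mem_ideal)
      ultimately show "a = b \<or> (a, b) \<in> r \<or> (b, a) \<in> r"
        using ord inj_onD[OF injB _ ab] by blast
    qed
    ultimately show "\<exists>C. poset_chain P r C \<and> C \<subseteq> ideal z \<and> card C = card (\<phi> z)" by blast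
  next
    fix C assume "poset_chain P r C \<and> C \<subseteq> ideal z"
    then have C: "poset_chain P r C" "C \<subseteq> ideal z" by auto
    have Cx: "\<And>c. c \<in> C \<Longrightarrow> (c, x) \<in> r" "\<And>c. c \<in> C \<Longrightarrow> (c, z) \<in> r"
      using C(2) sub by (auto simp: mem_ideal)
    have "poset_chain ?D ?O (\<phi> ` C)"
      unfolding poset_chain_iff
    proof (intro conjI ballI)
      show "\<phi> ` C \<subseteq> ?D" using C(2) sub im by auto
      fix a b assume "a \<in> \<phi> ` C" "b \<in> \<phi> ` C"
      then obtain c d where cd: "c \<in> C" "d \<in> C" "a = \<phi> c" "b = \<phi> d" by blast
      then have "c = d \<or> (c, d) \<in> r \<or> (d, c) \<in> r" using C(1) unfolding poset_chain_iff by blast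
      then show "a = b \<or> (a, b) \<in> ?O \<or> (b, a) \<in> ?O"
        using cd ord[OF Cx(1)[OF cd(1)] Cx(1)[OF cd(2)]] ord[OF Cx(1)[OF cd(2)] Cx(1)[OF cd(1)]] by auto
    qed
    moreover have "\<phi> ` C \<subseteq> principal_ideal ?D ?O (\<phi> z)"
    proof
      fix a assume "a \<in> \<phi> ` C"
      then obtain c where c: "c \<in> C" "a = \<phi> c" by blast
      then have "(\<phi> c, \<phi> z) \<in> ?O" "c \<in> ideal x"
        using ord[OF Cx(1)[OF c(1)] z] Cx[OF c(1)] by (simp_all add: mem_ideal)
      then show "a \<in> principal_ideal ?D ?O (\<phi> z)" using c im by (auto simp: principal_ideal_def)
    qed
    ultimately have "card (\<phi> ` C) \<le> card (\<phi> z)" using h by (auto simp: is_height_def)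
    moreover have "card (\<phi> ` C) = card C"
      using inj_on_subset[OF inj] C(2) sub by (intro card_image) blast
    ultimately show "card C \<le> card (\<phi> z)" by simp
  qed
qed

text \<open>The greatest element of the ideal goes to the finest partition, into
  \<open>n + 1\<close> singletons.\<close>

lemma iso_top:
  assumes \<phi>: "dual_partition_iso (ideal x) r n \<phi>" and x: "x \<in> P"
  shows "card (\<phi> x) = Suc n"
proof -
  let ?A = "{1..n+1}"
  note bij = iso_props(2)[OF \<phi>] and ord = iso_props(3)[OF \<phi>]
  have "(\<lambda>c. {c}) ` ?A \<in> \<phi> ` ideal x"
    unfolding bij dual_partitions_def using partition_on_singletons by blast
  then obtain w where w: "(w, x) \<in> r" "\<phi> w = (\<lambda>c. {c}) ` ?A" by (auto simp: mem_ideal)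
  then have "refines ?A (\<phi> x) ((\<lambda>c. {c}) ` ?A)"
    using ord[OF w(1) order_refl[OF x]] by (simp add: dual_partition_order_def)
  moreover from this have "refines ?A ((\<lambda>c. {c}) ` ?A) (\<phi> x)"
    by (intro singletons_refine) (simp add: refines_def)
  ultimately have "\<phi> x = (\<lambda>c. {c}) ` ?A" by (rule refines_asym)
  then show ?thesis using card_singletons[of ?A] by simp
qed

text \<open>Heights justify the \<open>THE\<close> in \<open>rank_of\<close>: isomorphisms with
  parameters \<open>m\<close> and \<open>n\<close> give \<open>x\<close> the heights
  \<open>m + 1\<close> and \<open>n + 1\<close>.\<close>

lemma rank_eqI:
  assumes "dual_partition_iso (ideal x) r n \<phi>" "x \<in> P"
  shows "rk x = n"
  unfolding rank_of_def
proof (rule the_equality)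
  fix m assume "\<exists>\<psi>. dual_partition_iso (ideal x) r m \<psi>"
  then obtain \<psi> where "dual_partition_iso (ideal x) r m \<psi>" by blast
  then have h: "is_height P r x (Suc m)" "is_height P r x (Suc n)"
    using iso_height[of x m \<psi> x] iso_height[OF assms(1), of x] assms iso_top order_refl by auto
  show "m = n" using is_height_unique[OF h] by simp
qed (use assms in blast)

lemma rank_iso:
  assumes "x \<in> P"
  obtains \<phi> where "dual_partition_iso (ideal x) r (rk x) \<phi>"
proof -
  obtain m \<phi> where "dual_partition_iso (ideal x) r m \<phi>"
    using assms partition_poset unfolding partition_poset_def by blast
  with rank_eqI[OF this assms] that[of \<phi>] show thesis by simp
qed

lemma rank_height:
  assumes "x \<in> P"
  shows "is_height P r x (Suc (rk x))"
proof -
  obtain \<phi> where "dual_partition_iso (ideal x) r (rk x) \<phi>" using rank_iso[OF assms] .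
  then show ?thesis using iso_height[of x "rk x" \<phi> x] iso_top assms order_refl by auto
qed

text \<open>The height of \<open>z\<close> can be computed in its own ideal or, through
  \<open>\<phi>\<close>, in the ideal of \<open>x\<close>.\<close>

lemma rank_card:
  assumes "dual_partition_iso (ideal x) r n \<phi>" "(z, x) \<in> r"
  shows "card (\<phi> z) = Suc (rk z)"
  by (rule is_height_unique[OF iso_height[OF assms] rank_height]) (use order_carrier[OF assms(2)] in simp)

lemma rank_strict:
  assumes "(z, x) \<in> r" "z \<noteq> x"
  shows "rk z < rk x"
proof -
  have x: "x \<in> P" using order_carrier assms by blast
  obtain \<phi> where \<phi>: "dual_partition_iso (ideal x) r (rk x) \<phi>" using rank_iso[OF x] .
  have "(\<phi> z, \<phi> x) \<in> dual_partition_order (rk x)" "\<phi> z \<noteq> \<phi> x"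
    using iso_props(3)[OF \<phi> assms(1) order_refl[OF x]] inj_onD[OF iso_props(1)[OF \<phi>], of z x]
      assms order_refl[OF x] by (auto simp: mem_ideal)
  then have ref: "refines {1..rk x + 1} (\<phi> x) (\<phi> z)" "\<phi> z \<noteq> \<phi> x" by (auto simp: dual_partition_order_def)
  then have "card (\<phi> z) < card (\<phi> x)"
    using refines_card[OF ref(1)] by (metis finite_atLeastAtMost nat_less_le)
  then show ?thesis using rank_card[OF \<phi>] assms(1) order_refl[OF x] by simp
qed

lemma rank_mono: "(z, x) \<in> r \<Longrightarrow> rk z \<le> rk x"
  using rank_strict[of z x] by (cases "z = x") auto

lemma rank_of_down_closed:
  assumes "H \<subseteq> P" "\<And>x z. x \<in> H \<Longrightarrow> (z, x) \<in> r \<Longrightarrow> z \<in> H" "x \<in> H"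
  shows "rank_of H r x = rk x"
proof -
  have "principal_ideal H r x = ideal x" using assms by (auto simp: principal_ideal_def)
  then show ?thesis by (simp add: rank_of_def)
qed

text \<open>By finiteness some element of \<open>H\<close> above \<open>x\<close> has greatest rank,
  and ranks increase strictly, so it is maximal.\<close>

lemma below_facet:
  assumes "H \<subseteq> P" "x \<in> H"
  obtains y where "y \<in> facets H r" "(x, y) \<in> r"
proof -
  let ?U = "{y \<in> H. (x, y) \<in> r}"
  have "finite ?U" "x \<in> ?U" using finite_subset[OF assms(1) fin] assms order_refl by auto
  then have U: "finite (rk ` ?U)" "rk ` ?U \<noteq> {}" by auto
  then obtain y where y: "y \<in> ?U" "rk y = Max (rk ` ?U)" using Max_in[OF U] by fastforce
  then have ymax: "rk z \<le> rk y" if "z \<in> ?U" for z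
    using Max_ge[OF U(1), of "rk z"] that by simp
  have "y \<in> facets H r"
    unfolding facets_def
  proof (intro CollectI conjI ballI impI)
    show "y \<in> H" using y by simp
    fix z assume z: "z \<in> H" "(y, z) \<in> r"
    then have "z \<in> ?U" using y(1) order_trans[OF _ z(2)] by blast
    then show "z = y" using ymax[of z] rank_strict[OF z(2)] by fastforce
  qed
  then show thesis using that y(1) by blast
qed

text \<open>A longest chain in the ideal of a facet \<open>y\<close> is a maximal chain of
  \<open>H\<close> with \<open>rk y + 1\<close> elements, so purity gives all facets the same rank;
  every element of \<open>H\<close> lies below some facet.\<close>

lemma pure_facet_rank:
  assumes H: "H \<subseteq> P" "\<And>x z. x \<in> H \<Longrightarrow> (z, x) \<in> r \<Longrightarrow> z \<in> H" and pure: "pure_poset H r"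
    and y: "y \<in> facets H r"
  shows "rk y = poset_rank H r"
proof -
  have chain: "\<exists>C. poset_maxchain H r C \<and> card C = Suc (rk y)" if y: "y \<in> facets H r" for y
  proof -
    have yH: "y \<in> H" using y by (simp add: facets_def)
    then have yP: "y \<in> P" using H by blast
    have idH: "ideal y \<subseteq> H" using H(2) yH by (auto simp: mem_ideal)
    have ub: "\<And>C. poset_chain P r C \<Longrightarrow> C \<subseteq> ideal y \<Longrightarrow> card C \<le> Suc (rk y)"
      and ex: "\<exists>C. poset_chain P r C \<and> C \<subseteq> ideal y \<and> card C = Suc (rk y)"
      using rank_height[OF yP] by (auto simp: is_height_def)
    obtain C where C: "poset_chain P r C" "C \<subseteq> ideal y" "card C = Suc (rk y)" using ex by blast
    have finC: "finite C" using C(3) card.infinite by fastforce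
    have "y \<in> C"
    proof (rule ccontr)
      assume "y \<notin> C"
      moreover have "poset_chain P r (insert y C)" "insert y C \<subseteq> ideal y"
        using C yP order_refl by (auto simp: poset_chain_iff mem_ideal)
      ultimately show False using ub[of "insert y C"] C(3) finC by simp
    qed
    have "poset_chain H r C" using C idH by (auto simp: poset_chain_iff)
    \<comment> \<open>A chain of \<open>H\<close> through the facet \<open>y\<close> cannot leave
      the ideal of \<open>y\<close>, where \<open>C\<close> already has the greatest possible
      size.\<close>
    moreover have False if S: "poset_chain H r S" "C \<subset> S" for S
    proof -
      have "S \<subseteq> ideal y"
      proof
        fix s assume "s \<in> S"
        then have "s \<in> H" "s = y \<or> (s, y) \<in> r \<or> (y, s) \<in> r"
          using S \<open>y \<in> C\<close> by (auto simp: poset_chain_iff)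
        then show "s \<in> ideal y" using y order_refl[OF yP] by (auto simp: facets_def mem_ideal)
      qed
      moreover have "poset_chain P r S" using S H by (auto simp: poset_chain_iff)
      ultimately have "card S \<le> Suc (rk y)" using ub by blast
      moreover have "S \<subseteq> P" using S(1) H(1) by (auto simp: poset_chain_iff)
      from finite_subset[OF this fin] have "finite S" .
      ultimately show False using psubset_card_mono[OF _ S(2)] C(3) by simp
    qed
    ultimately show ?thesis using C(3) unfolding pred_on.maxchain_def by blast
  qed
  have yH: "y \<in> H" using y by (simp add: facets_def)
  have "rank_of H r ` H = rk ` H"
    by (rule image_cong[OF refl rank_of_down_closed[OF H]])
  then have "poset_rank H r = Max (rk ` H)" by (simp add: poset_rank_def)
  also have "\<dots> = rk y"
  proof (rule Max_eqI)
    show "finite (rk ` H)" by (rule finite_imageI[OF finite_subset[OF H(1) fin]])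
    show "rk y \<in> rk ` H" using yH by blast
    fix k assume "k \<in> rk ` H"
    then obtain x where x: "x \<in> H" "k = rk x" by blast
    obtain y' where y': "y' \<in> facets H r" "(x, y') \<in> r" using below_facet[OF H(1) x(1)] .
    obtain C D where CD: "poset_maxchain H r C" "card C = Suc (rk y')" "poset_maxchain H r D" "card D = Suc (rk y)"
      using chain[OF y'(1)] chain[OF y] by blast
    have "card C = card D"
      by (rule pure[unfolded pure_poset_def, rule_format]) (rule conjI[OF CD(1,3)])
    then have "rk y' = rk y" using CD by simp
    then show "k \<le> rk y" using rank_mono[OF y'(2)] x by simp
  qed
  finally show ?thesis by simp
qed

text \<open>The factor \<open>t\<close> makes up for ranks being one less than block counts.\<close>

lemma stable_rank_sum:
  assumes \<phi>: "dual_partition_iso (ideal x) r n \<phi>" and I: "I \<subseteq> ideal x"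
    and st: "\<And>z. z \<in> ideal x \<Longrightarrow> z \<in> I \<longleftrightarrow> \<phi> z \<in> stable_partitions {1..n+1} E"
  shows "monom 1 1 * (\<Sum>z\<in>I. monom 1 (rk z)) = stable_poly {1..n+1} E"
proof -
  note bij = iso_props(1,2)[OF \<phi>]
  have "\<phi> ` I = stable_partitions {1..n+1} E"
  proof (intro subset_antisym subsetI)
    fix \<pi> assume \<pi>: "\<pi> \<in> stable_partitions {1..n+1} E"
    then have "\<pi> \<in> \<phi> ` ideal x" unfolding bij by (simp add: stable_partitions_def dual_partitions_def)
    then obtain z where z: "z \<in> ideal x" "\<pi> = \<phi> z" by blast
    then show "\<pi> \<in> \<phi> ` I" using st[OF z(1)] \<pi> by simp
  next
    fix \<pi> assume "\<pi> \<in> \<phi> ` I"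
    then obtain z where z: "z \<in> I" "\<pi> = \<phi> z" by blast
    then show "\<pi> \<in> stable_partitions {1..n+1} E" using st[of z] I by auto
  qed
  then have "stable_poly {1..n+1} E = (\<Sum>z\<in>I. monom 1 (card (\<phi> z)))"
    unfolding stable_poly_def by (metis (mono_tags) sum.reindex_cong[OF inj_on_subset[OF bij(1) I]])
  also have "\<dots> = (\<Sum>z\<in>I. monom 1 1 * monom 1 (rk z))"
    using rank_card[OF \<phi>] I by (intro sum.cong) (auto simp: mem_ideal mult_monom subset_iff)
  finally show ?thesis by (simp add: sum_distrib_left)
qed

end


section \<open>Shellings and the h-vector\<close>

definition pair_partition :: "'v set \<Rightarrow> 'v \<Rightarrow> 'v \<Rightarrow> 'v set set" where
  "pair_partition A a b = insert {a, b} ((\<lambda>c. {c}) ` (A - {a, b}))"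

lemma pair_partition_on: "a \<in> A \<Longrightarrow> b \<in> A \<Longrightarrow> partition_on A (pair_partition A a b)"
  unfolding pair_partition_def partition_on_def by (auto simp: pairwise_def disjnt_iff)

lemma card_pair_partition:
  assumes "finite A" "a \<in> A" "b \<in> A" "a \<noteq> b"
  shows "Suc (card (pair_partition A a b)) = card A"
proof -
  have "{a, b} \<notin> (\<lambda>c. {c}) ` (A - {a, b})" using assms by (auto simp: doubleton_eq_iff)
  then have "card (pair_partition A a b) = Suc (card (A - {a, b}))"
    using assms by (simp add: pair_partition_def card_image)
  also have "\<dots> = Suc (card A - 2)" using assms by (simp add: card_Diff_subset)
  finally show ?thesis using card_mono[of A "{a, b}"] assms by simp
qed

lemma pair_partition_refines:
  assumes "partition_on A \<pi>" "a \<in> A" "b \<in> A"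
  shows "refines A (pair_partition A a b) \<pi> \<longleftrightarrow> (\<exists>B\<in>\<pi>. {a, b} \<subseteq> B)"
proof
  assume "refines A (pair_partition A a b) \<pi>"
  then show "\<exists>B\<in>\<pi>. {a, b} \<subseteq> B" by (auto simp: refines_def pair_partition_def)
next
  assume *: "\<exists>B\<in>\<pi>. {a, b} \<subseteq> B"
  have "\<exists>B\<in>\<pi>. {c} \<subseteq> B" if "c \<in> A" for c
    using assms(1) that by (auto simp: partition_on_def)
  with * show "refines A (pair_partition A a b) \<pi>"
    unfolding refines_def using assms pair_partition_on[OF assms(2,3)]
    by (auto simp: pair_partition_def)
qed

text \<open>If all blocks were singletons there would be \<open>card A\<close> of them, one too
  many. Two elements \<open>a\<close> and \<open>b\<close> of one block make the pair partition a
  refinement of \<open>\<pi>\<close> with as many blocks, hence equal to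
  \<open>\<pi>\<close>.\<close>

lemma corank_one_partition:
  assumes "partition_on A \<pi>" "finite A" "Suc (card \<pi>) = card A"
  obtains a b where "a \<in> A" "b \<in> A" "a \<noteq> b" "\<pi> = pair_partition A a b"
proof -
  have "\<exists>B\<in>\<pi>. \<exists>a\<in>B. \<exists>b\<in>B. a \<noteq> b"
  proof (rule ccontr)
    assume *: "\<not> ?thesis"
    have "refines A \<pi> ((\<lambda>c. {c}) ` A)"
      unfolding refines_def
    proof (intro conjI ballI)
      fix B assume B: "B \<in> \<pi>"
      then have "B \<noteq> {}" "B \<subseteq> A" using assms(1) by (auto simp: partition_on_def)
      then obtain c where "c \<in> B" by blast
      then have "B \<subseteq> {c}" "c \<in> A" using * B \<open>B \<subseteq> A\<close> by auto
      then show "\<exists>Y\<in>(\<lambda>c. {c}) ` A. B \<subseteq> Y" by blast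
    qed (use assms(1) partition_on_singletons in auto)
    from refines_card(1)[OF this assms(2)] show False
      using assms(3) card_singletons[of A] by simp
  qed
  then obtain B a b where B: "B \<in> \<pi>" "a \<in> B" "b \<in> B" "a \<noteq> b" by blast
  then have ab: "a \<in> A" "b \<in> A" using assms(1) by (auto simp: partition_on_def)
  have "refines A (pair_partition A a b) \<pi>"
    using pair_partition_refines[OF assms(1) ab] B by blast
  moreover have "card \<pi> = card (pair_partition A a b)"
    using card_pair_partition[OF assms(2) ab B(4)] assms(3) by simp
  ultimately have "pair_partition A a b = \<pi>" using refines_card(2) assms(2) by blast
  then show thesis using that ab B(4) by blast
qed

lemma graph_edges_pair_partition:
  "graph_edges n \<phi> H r = {{a, b} | a b. a \<in> {1..n+1} \<and> b \<in> {1..n+1} \<and> a \<noteq> b \<and>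
     (\<exists>z\<in>facets H r. \<phi> z = pair_partition {1..n+1} a b)}"
  by (simp add: graph_edges_def pair_partition_def)

lemma simple_edges_graph_edges: "simple_edges {1..n+1} (graph_edges n \<phi> H r)"
  unfolding simple_edges_def graph_edges_def by blast

text \<open>Linear independence of the \<open>R_poly\<close> gives the uniqueness behind the
  \<open>THE\<close>; cutting \<open>h\<close> off beyond the rank meets its normalization.\<close>

lemma h_vector_eqI:
  assumes "(\<Sum>x\<in>P. monom 1 (rank_of P r x)) = (\<Sum>k\<le>poset_rank P r. smult (h k) (R_poly (poset_rank P r) k))"
    and "k \<le> poset_rank P r"
  shows "h_vector P r k = h k"
proof -
  let ?n = "poset_rank P r"
  define g where "g = (\<lambda>k. if k \<le> ?n then h k else 0)"
  have "h_vector P r = g"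
    unfolding h_vector_def
  proof (rule the_equality)
    show "(\<forall>k>?n. g k = 0) \<and>
      (\<Sum>x\<in>P. monom 1 (rank_of P r x)) = (\<Sum>k\<le>?n. smult (g k) (R_poly ?n k))"
      unfolding assms(1) by (simp add: g_def)
  next
    fix g' assume g': "(\<forall>k>?n. g' k = 0) \<and>
      (\<Sum>x\<in>P. monom 1 (rank_of P r x)) = (\<Sum>k\<le>?n. smult (g' k) (R_poly ?n k))"
    then have "(\<Sum>k\<le>?n. smult (g' k - h k) (R_poly ?n k)) = 0"
      using assms(1) by (simp add: smult_diff_left sum_subtractf)
    then have "g' k = h k" if "k \<le> ?n" for k
      using R_poly_independent[OF _ that, of "\<lambda>k. g' k - h k"] by simp
    then show "g' = g" using g' by (auto simp: g_def)
  qed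
  then show ?thesis using assms(2) by (simp add: g_def)
qed

section \<open>Decomposition of the poset along a shelling\<close>

context partition_pos
begin

text \<open>The facets of \<open>H\<close> have rank \<open>n - 1\<close>, so they are the pair
  partitions given by the edges. Lying below such a facet means having both ends of its edge in one
  block, and every element of \<open>H\<close> lies below a facet.\<close>

lemma shelling_ideal_stable:
  assumes H: "H \<subseteq> ideal y" "\<And>x z. x \<in> H \<Longrightarrow> (z, x) \<in> r \<Longrightarrow> z \<in> H"
    and pure: "pure_poset H r" and rank: "poset_rank H r + 1 = n"
    and \<phi>: "dual_partition_iso (ideal y) r n \<phi>" and x: "x \<in> ideal y"
  shows "x \<notin> H \<longleftrightarrow> \<phi> x \<in> stable_partitions {1..n+1} (graph_edges n \<phi> H r)"
proof -
  let ?A = "{1..n+1}" and ?E = "graph_edges n \<phi> H r"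
  have HP: "H \<subseteq> P" using H(1) by (auto simp: principal_ideal_def)
  have im: "\<phi> z \<in> dual_partitions n" if "z \<in> ideal y" for z using iso_props(2)[OF \<phi>] that by blast
  have px: "partition_on ?A (\<phi> x)" using im[OF x] by (simp add: dual_partitions_def)
  have ref: "(x, z) \<in> r \<longleftrightarrow> refines ?A (\<phi> z) (\<phi> x)" if "z \<in> ideal y" for z
    using iso_props(3)[OF \<phi>, of x z] x that by (simp add: mem_ideal dual_partition_order_def)
  have "x \<in> H" if nst: "\<phi> x \<notin> stable_partitions ?A ?E"
  proof -
    obtain B e where B: "B \<in> \<phi> x" "e \<in> ?E" "e \<subseteq> B"
      using nst px by (auto simp: stable_partitions_def)
    then obtain a b z where ab: "e = {a, b}" "a \<in> ?A" "b \<in> ?A" and z: "z \<in> facets H r" "\<phi> z = pair_partition ?A a b"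
      by (auto simp only: graph_edges_pair_partition)
    have zH: "z \<in> H" using z(1) by (simp add: facets_def)
    have "refines ?A (\<phi> z) (\<phi> x)"
      unfolding z(2) pair_partition_refines[OF px ab(2,3)] using B ab(1) by blast
    then have "(x, z) \<in> r" using ref[of z] zH H(1) by blast
    then show "x \<in> H" by (rule H(2)[OF zH])
  qed
  moreover have "\<phi> x \<notin> stable_partitions ?A ?E" if xH: "x \<in> H"
  proof -
    obtain z where z: "z \<in> facets H r" "(x, z) \<in> r" using below_facet[OF HP xH] .
    have zy: "z \<in> ideal y" using z(1) H(1) by (auto simp: facets_def)
    have "rk z = poset_rank H r" by (rule pure_facet_rank[OF HP H(2) pure z(1)])
    then have "Suc (card (\<phi> z)) = card ?A"
      using rank_card[OF \<phi>, of z] zy rank by (simp add: mem_ideal)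
    moreover have "partition_on ?A (\<phi> z)" using im[OF zy] by (simp add: dual_partitions_def)
    ultimately obtain a b where ab: "a \<in> ?A" "b \<in> ?A" "a \<noteq> b" "\<phi> z = pair_partition ?A a b"
      using corank_one_partition[of ?A "\<phi> z"] by blast
    have "{a, b} \<in> ?E" unfolding graph_edges_pair_partition using ab z(1) by blast
    moreover have "\<exists>B\<in>\<phi> x. {a, b} \<subseteq> B"
      using ref[OF zy] z(2) unfolding ab(4) pair_partition_refines[OF px ab(1,2)] by simp
    ultimately show ?thesis unfolding stable_partitions_def by blast
  qed
  ultimately show ?thesis by blast
qed

text \<open>The \<open>j\<close>-th facet contributes the elements that belong to no earlier ideal.
  These sets partition \<open>P\<close>, each has a rank polynomial with nonnegative coefficients in
  the \<open>R_poly n k\<close>, and the coefficients add up.\<close>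

lemma shelling_h_vector:
  assumes pure: "pure_poset P r" and ys: "Pi_shelling P r ys"
  obtains h where "\<And>k. 0 \<le> h k"
    and "(\<Sum>x\<in>P. monom 1 (rk x)) = (\<Sum>k\<le>poset_rank P r. smult (h k) (R_poly (poset_rank P r) k))"
proof -
  define n where "n = poset_rank P r"
  define I where "I = (\<lambda>j. ideal (ys ! j))"
  have fac: "set ys = facets P r" using ys by (simp add: Pi_shelling_def)
  have yP: "ys ! j \<in> P" "rk (ys ! j) = n" if "j < length ys" for j
  proof -
    have y: "ys ! j \<in> facets P r" using fac that nth_mem by blast
    then show "ys ! j \<in> P" by (simp add: facets_def)
    show "rk (ys ! j) = n"
      unfolding n_def by (rule pure_facet_rank[OF subset_refl _ pure y]) (use order_carrier in blast)
  qed
  have part: "\<exists>h. (\<forall>k. 0 \<le> h k) \<and> (\<Sum>x\<in>disjointed I j. monom 1 (rk x)) = (\<Sum>k\<le>n. smult (h k) (R_poly n k))"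
    if j: "j < length ys" for j
  proof -
    have "\<exists>\<phi> E. dual_partition_iso (I j) r n \<phi> \<and> chordal {1..n+1} E \<and> simple_edges {1..n+1} E \<and>
      (\<forall>x\<in>I j. x \<in> disjointed I j \<longleftrightarrow> \<phi> x \<in> stable_partitions {1..n+1} E)"
    \<comment> \<open>The shelling provides a graph only for the later facets; for the first one the
      edgeless graph makes every partition stable.\<close>
    proof (cases "j = 0")
      case True
      obtain \<phi> where \<phi>: "dual_partition_iso (I j) r n \<phi>"
        using rank_iso[OF yP(1)[OF j]] yP(2)[OF j] I_def by metis
      have "\<phi> x \<in> stable_partitions {1..n+1} {}" if "x \<in> I j" for x
      proof -
        have "\<phi> x \<in> dual_partitions n"
          using iso_props(2)[OF \<phi>[unfolded I_def]] that I_def by blast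
        then show ?thesis by (simp add: dual_partitions_def stable_partitions_def)
      qed
      moreover have "disjointed I j = I j" using True by (simp add: disjointed_def)
      moreover have "chordal {1..n+1} {}" by (rule chordal_empty_edges) simp
      ultimately show ?thesis using \<phi>
        by (intro exI[of _ \<phi>] exI[of _ "{}"]) (simp add: simple_edges_def)
    next
      case False
      define H where "H = shelling_subposet P r ys j"
      have H: "H = I j \<inter> (\<Union>i<j. I i)" by (simp add: H_def I_def shelling_subposet_def)
      have "pure_poset H r" "poset_rank H r + 1 = n"
        using ys False j unfolding Pi_shelling_def H_def n_def by auto
      moreover obtain \<phi> where \<phi>: "dual_partition_iso (I j) r n \<phi>" "chordal {1..n+1} (graph_edges n \<phi> H r)"
        using ys False j unfolding Pi_shelling_def H_def n_def I_def by blast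
      moreover have "H \<subseteq> ideal (ys ! j)" using H by (simp add: I_def)
      moreover have "z \<in> H" if "x \<in> H" "(z, x) \<in> r" for x z
        using that order_trans[OF that(2)] by (auto simp: H I_def mem_ideal)
      ultimately have st: "x \<notin> H \<longleftrightarrow> \<phi> x \<in> stable_partitions {1..n+1} (graph_edges n \<phi> H r)" if "x \<in> I j" for x
        using shelling_ideal_stable[of H "ys ! j" n \<phi> x] that unfolding I_def by blast
      have "x \<in> disjointed I j \<longleftrightarrow> x \<notin> H" if "x \<in> I j" for x
        using that by (auto simp: disjointed_def H lessThan_atLeast0)
      then show ?thesis using \<phi> st simple_edges_graph_edges
        by (intro exI[of _ \<phi>] exI[of _ "graph_edges n \<phi> H r"]) simp
    qed
    then obtain \<phi> E where \<phi>: "dual_partition_iso (I j) r n \<phi>" and E: "chordal {1..n+1} E" "simple_edges {1..n+1} E"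
      and st: "\<And>x. x \<in> I j \<Longrightarrow> x \<in> disjointed I j \<longleftrightarrow> \<phi> x \<in> stable_partitions {1..n+1} E" by blast
    obtain h where h: "\<forall>k. 0 \<le> h k" "stable_poly {1..n+1} E = monom 1 1 * (\<Sum>k\<le>n. smult (h k) (R_poly n k))"
      using chordal_stable_poly_R[OF E, of n] by auto
    have "monom 1 1 * (\<Sum>x\<in>disjointed I j. monom 1 (rk x)) = stable_poly {1..n+1} E"
      by (rule stable_rank_sum[OF \<phi>[unfolded I_def]]) (use st disjointed_subset[of I j] in \<open>auto simp: I_def\<close>)
    then have "monom 1 1 * (\<Sum>x\<in>disjointed I j. monom 1 (rk x)) = monom 1 1 * (\<Sum>k\<le>n. smult (h k) (R_poly n k))"
      using h(2) by simp
    then have "(\<Sum>x\<in>disjointed I j. monom 1 (rk x)) = (\<Sum>k\<le>n. smult (h k) (R_poly n k))"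
      by (simp del: One_nat_def)
    then show ?thesis using h(1) by blast
  qed
  then obtain h where h: "\<And>j k. j < length ys \<Longrightarrow> 0 \<le> h j k"
    "\<And>j. j < length ys \<Longrightarrow> (\<Sum>x\<in>disjointed I j. monom 1 (rk x)) = (\<Sum>k\<le>n. smult (h j k) (R_poly n k))"
    by metis
  have "P = (\<Union>j<length ys. I j)"
  proof
    show "P \<subseteq> (\<Union>j<length ys. I j)"
    proof
      fix x assume "x \<in> P"
      then obtain y where y: "y \<in> facets P r" "(x, y) \<in> r" using below_facet[OF subset_refl] by blast
      then obtain j where "j < length ys" "y = ys ! j" using fac by (metis in_set_conv_nth)
      then show "x \<in> (\<Union>j<length ys. I j)" using y(2) by (auto simp: I_def mem_ideal)
    qed
  qed (auto simp: I_def principal_ideal_def)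
  also have "\<dots> = (\<Union>j<length ys. disjointed I j)"
    using finite_UN_disjointed_eq[of I "length ys"] by (simp add: lessThan_atLeast0)
  finally have P: "P = (\<Union>j<length ys. disjointed I j)" .
  have "(\<Sum>x\<in>P. monom 1 (rk x)) = (\<Sum>j<length ys. \<Sum>x\<in>disjointed I j. monom 1 (rk x) :: real poly)"
    unfolding P
  proof (rule sum.UNION_disjoint)
    show "\<forall>j\<in>{..<length ys}. finite (disjointed I j)"
      using P fin by (auto intro: finite_subset[of _ P])
    show "\<forall>i\<in>{..<length ys}. \<forall>j\<in>{..<length ys}. i \<noteq> j \<longrightarrow> disjointed I i \<inter> disjointed I j = {}"
      using disjoint_family_disjointed[of I] by (simp add: disjoint_family_on_def)
  qed simp
  also have "\<dots> = (\<Sum>j<length ys. \<Sum>k\<le>n. smult (h j k) (R_poly n k))"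
    using h(2) by simp
  also have "\<dots> = (\<Sum>k\<le>n. smult (\<Sum>j<length ys. h j k) (R_poly n k))"
    by (subst sum.swap) (simp add: smult_sum)
  finally show thesis
    by (intro that[of "\<lambda>k. \<Sum>j<length ys. h j k"] sum_nonneg) (simp_all add: h(1) n_def)
qed

end


section \<open>Chain polynomials\<close>

text \<open>\<open>T\<close> raises the degree by one and keeps the leading coefficient, starting
  from \<open>t^m\<close>.\<close>

lemma coeff_Q_poly_top: "m \<le> N \<Longrightarrow> coeff (Q_poly N m) N = 1 \<and> (\<forall>j>N. coeff (Q_poly N m) j = 0)"
proof (induction "N - m" arbitrary: N)
  case 0
  then show ?case by simp
next
  case (Suc d)
  then obtain N' where N': "N = Suc N'" "m \<le> N'" by (cases N) auto
  show ?case using Suc N' by (auto simp: euler_shift_Q[symmetric] coeff_euler_shift)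
qed

lemma coeff_R_poly_top: "k \<le> n \<Longrightarrow> coeff (R_poly n k) n = 1" "k \<le> n \<Longrightarrow> n < j \<Longrightarrow> coeff (R_poly n k) j = 0"
  using coeff_Q_poly_top[of "Suc k" "Suc n"] by (simp_all add: coeff_R_poly)

lemma coeff_R_poly_zero_zero: "coeff (R_poly n 0) 0 = 1"
  using coeff_Q_poly_diag[of 1 "Suc n"] by (simp add: coeff_R_poly)

text \<open>Each isolated vertex applies \<open>T\<close>, beginning with the constant
  \<open>1\<close>.\<close>

lemma stable_poly_no_edges:
  assumes "finite V"
  shows "stable_poly V {} = Q_poly (card V) 0"
  using assms
proof (induction V rule: finite_induct)
  case empty
  then show ?case by (simp add: stable_poly_empty del: Q_poly_self)
next
  case (insert v V)
  have "stable_poly (insert v V) {} = euler_shift (stable_poly V {})"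
    using stable_poly_simplicial(1)[of "insert v V" v "{}"] insert by (simp add: simple_edges_def)
  then show ?case using insert by (simp add: euler_shift_Q)
qed

section \<open>Chains enumerated by their greatest element\<close>

text \<open>Such a sum is linear in the rank polynomial of \<open>A\<close>, which is how expansions
  in the \<open>R_poly\<close> enter chain polynomials.\<close>

lemma sum_rank_linear:
  fixes g :: "nat \<Rightarrow> real poly"
  assumes "finite A" "\<And>x. x \<in> A \<Longrightarrow> \<rho> x \<le> n"
  shows "(\<Sum>x\<in>A. g (\<rho> x)) = (\<Sum>j\<le>n. smult (coeff (\<Sum>x\<in>A. monom 1 (\<rho> x)) j) (g j))"
  using assms
proof (induction A rule: finite_induct)
  case (insert a A)
  have "(\<Sum>j\<le>n. smult (coeff (monom 1 (\<rho> a)) j) (g j)) = (\<Sum>j\<le>n. if j = \<rho> a then g (\<rho> a) else 0)"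
    by (intro sum.cong) auto
  then have "(\<Sum>j\<le>n. smult (coeff (monom 1 (\<rho> a)) j) (g j)) = g (\<rho> a)"
    using insert.prems by simp
  then show ?case using insert by (simp add: smult_add_left sum.distrib del: coeff_monom)
qed simp

text \<open>The chain polynomial of the selected ranks strictly below an element of rank
  \<open>k\<close>, which depends on \<open>k\<close> only. The coefficient of \<open>t^j\<close> in
  \<open>R_poly k 0\<close> counts the elements of rank \<open>j\<close> in its ideal.\<close>

function below_poly :: "nat set \<Rightarrow> nat \<Rightarrow> real poly" where
  "below_poly S k = 1 + (\<Sum>j<k. if j \<in> S then smult (coeff (R_poly k 0) j) (monom 1 1 * below_poly S j) else 0)"
  by auto
termination by (relation "measure snd") auto

declare below_poly.simps [simp del]

context partition_pos
begin

text \<open>All partitions are stable in the edgeless graph, and \<open>Q_poly (Suc n) 0\<close>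
  agrees with \<open>Q_poly (Suc n) 1\<close>, which is \<open>t R_poly n 0\<close>.\<close>

lemma ideal_rank_sum:
  assumes "x \<in> P"
  shows "(\<Sum>z\<in>ideal x. monom 1 (rk z)) = R_poly (rk x) 0"
proof -
  obtain \<phi> where \<phi>: "dual_partition_iso (ideal x) r (rk x) \<phi>" using rank_iso[OF assms] .
  have "\<phi> z \<in> stable_partitions {1..rk x + 1} {}" if "z \<in> ideal x" for z
    using iso_props(2)[OF \<phi>] that by (auto simp: stable_partitions_def dual_partitions_def)
  then have "monom 1 1 * (\<Sum>z\<in>ideal x. monom 1 (rk z)) = stable_poly {1..rk x + 1} {}"
    by (intro stable_rank_sum[OF \<phi>]) auto
  also have "\<dots> = monom 1 1 * R_poly (rk x) 0"
    using R_poly_Q[of 0 "rk x"] Q_poly_zero_one[of "rk x"] by (simp add: stable_poly_no_edges)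
  finally show ?thesis by (simp del: One_nat_def)
qed

text \<open>A nonempty chain is its greatest element together with a chain strictly below
  it.\<close>

lemma chain_poly_rec:
  assumes Q: "Q \<subseteq> P"
  shows "chain_poly Q r = 1 + (\<Sum>x\<in>Q. monom 1 1 * chain_poly {z \<in> Q. (z, x) \<in> r \<and> z \<noteq> x} r)"
proof -
  let ?b = "\<lambda>x. {z \<in> Q. (z, x) \<in> r \<and> z \<noteq> x}"
  let ?C = "\<lambda>X. {C. poset_chain X r C}"
  have finQ: "finite Q" using finite_subset[OF Q fin] .
  have finC: "finite (?C X)" if "X \<subseteq> Q" for X
    by (rule finite_subset[of _ "Pow Q"]) (use that finQ in \<open>auto simp: poset_chain_iff\<close>)
  let ?D = "Sigma Q (\<lambda>x. ?C (?b x))"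
  have max: "x \<notin> C" "\<And>z. z \<in> C \<Longrightarrow> (z, x) \<in> r \<and> z \<noteq> x" if "(x, C) \<in> ?D" for x C
    using that by (auto simp: poset_chain_iff)
  have inj: "inj_on (\<lambda>(x, C). insert x C) ?D"
  proof (rule inj_onI)
    fix p q assume pq: "p \<in> ?D" "q \<in> ?D" "(\<lambda>(x, C). insert x C) p = (\<lambda>(x, C). insert x C) q"
    obtain x C x' C' where p: "p = (x, C)" "q = (x', C')" by (cases p, cases q)
    have *: "(x, C) \<in> ?D" "(x', C') \<in> ?D" "insert x C = insert x' C'" using pq unfolding p by auto
    have "x' = x \<or> (x', x) \<in> r" using *(3) max(2)[OF *(1), of x'] by blast
    moreover have "x = x' \<or> (x, x') \<in> r" using *(3) max(2)[OF *(2), of x] by blast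
    ultimately have "x = x'" using order_antisym[of x x'] by blast
    then show "p = q"
      unfolding p using *(3) max(1)[OF *(1)] max(1)[OF *(2)] by (simp add: insert_ident)
  qed
  have "?C Q - {{}} = (\<lambda>(x, C). insert x C) ` ?D"
  proof (intro subset_antisym subsetI)
    fix C assume C: "C \<in> ?C Q - {{}}"
    then have CQ: "C \<subseteq> Q" and tot: "\<And>a b. a \<in> C \<Longrightarrow> b \<in> C \<Longrightarrow> a = b \<or> (a, b) \<in> r \<or> (b, a) \<in> r"
      by (auto simp: poset_chain_iff)
    \<comment> \<open>The elements of a chain are comparable, so one of maximal rank is the
      greatest.\<close>
    have U: "finite (rk ` C)" "rk ` C \<noteq> {}" using C finite_subset[OF CQ finQ] by auto
    then obtain x where x: "x \<in> C" "rk x = Max (rk ` C)" using Max_in[OF U] by fastforce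
    have below: "(z, x) \<in> r" if "z \<in> C" for z
    proof -
      have "rk z \<le> rk x" using Max_ge[OF U(1), of "rk z"] that x by simp
      then show ?thesis using tot[OF that x(1)] rank_strict[of x z] order_refl[of z] CQ Q that by fastforce
    qed
    have "(x, C - {x}) \<in> ?D"
      using x CQ tot below by (auto simp: poset_chain_iff)
    then show "C \<in> (\<lambda>(x, C). insert x C) ` ?D"
      using x(1) by (intro image_eqI[of _ _ "(x, C - {x})"]) auto
  next
    fix C assume "C \<in> (\<lambda>(x, C). insert x C) ` ?D"
    then show "C \<in> ?C Q - {{}}" by (auto simp: poset_chain_iff)
  qed
  then have "(\<Sum>C\<in>?C Q - {{}}. monom 1 (card C)) = (\<Sum>(x, C)\<in>?D. monom 1 (card (insert x C)) :: real poly)"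
    using sum.reindex[OF inj, of "\<lambda>C. monom 1 (card C)"] by (simp add: case_prod_unfold)
  also have "\<dots> = (\<Sum>x\<in>Q. \<Sum>C\<in>?C (?b x). monom 1 (card (insert x C)))"
    using finQ finC by (subst sum.Sigma) auto
  also have "\<dots> = (\<Sum>x\<in>Q. monom 1 1 * chain_poly (?b x) r)"
  proof (rule sum.cong[OF refl])
    fix x assume "x \<in> Q"
    have "monom 1 (card (insert x C)) = monom 1 1 * (monom 1 (card C) :: real poly)" if "C \<in> ?C (?b x)" for C
    proof -
      have "C \<subseteq> ?b x" using that by (simp add: poset_chain_iff)
      then have "x \<notin> C" "finite C" using finite_subset[OF _ finQ, of C] by auto
      then show ?thesis by (simp add: mult_monom)
    qed
    then show "(\<Sum>C\<in>?C (?b x). monom 1 (card (insert x C))) = monom 1 1 * chain_poly (?b x) r"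
      by (simp add: chain_poly_def sum_distrib_left)
  qed
  finally have "(\<Sum>C\<in>?C Q - {{}}. monom 1 (card C)) = (\<Sum>x\<in>Q. monom 1 1 * chain_poly (?b x) r)" .
  moreover have "chain_poly Q r = monom 1 (card {}) + (\<Sum>C\<in>?C Q - {{}}. monom 1 (card C))"
    unfolding chain_poly_def using finC[of Q]
    by (subst sum.remove[of "?C Q" "{}"]) (simp_all add: pred_on.chain_empty)
  ultimately show ?thesis by (simp add: monom_0)
qed

text \<open>After splitting off the greatest element \<open>y\<close>, the remaining chain lives in
  the same kind of set below \<open>y\<close>, so strong induction on the rank applies.\<close>

lemma rank_selected_chain_poly_below:
  "x \<in> P \<Longrightarrow> chain_poly {z \<in> rank_selected P r S. (z, x) \<in> r \<and> z \<noteq> x} r = below_poly S (rk x)"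
proof (induction "rk x" arbitrary: x rule: less_induct)
  case less
  let ?Q = "\<lambda>x. {z \<in> rank_selected P r S. (z, x) \<in> r \<and> z \<noteq> x}"
  \<comment> \<open>The condition \<open>j < rk x\<close> makes the term of \<open>x\<close> itself
    vanish, so that the sum can run over the full ideal, whose rank polynomial is known.\<close>
  let ?G = "\<lambda>j. if j \<in> S \<and> j < rk x then monom 1 1 * below_poly S j else 0"
  have eq: "{z \<in> ?Q x. (z, y) \<in> r \<and> z \<noteq> y} = ?Q y" if "y \<in> ?Q x" for y
    using that order_trans order_antisym by blast
  have Qsub: "?Q x \<subseteq> P" by (auto simp: rank_selected_def)
  have Q: "?Q x = {y \<in> ideal x. rk y \<in> S \<and> rk y < rk x}"
    using rank_strict order_carrier by (auto simp: rank_selected_def mem_ideal)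
  have fI: "finite (ideal x)" by (rule finite_subset[OF _ fin]) (auto simp: principal_ideal_def)
  have "chain_poly (?Q x) r = 1 + (\<Sum>y\<in>?Q x. monom 1 1 * chain_poly {z \<in> ?Q x. (z, y) \<in> r \<and> z \<noteq> y} r)"
    by (rule chain_poly_rec[OF Qsub])
  also have "(\<Sum>y\<in>?Q x. monom 1 1 * chain_poly {z \<in> ?Q x. (z, y) \<in> r \<and> z \<noteq> y} r) = (\<Sum>y\<in>?Q x. ?G (rk y))"
  proof (rule sum.cong[OF refl])
    fix y assume y: "y \<in> ?Q x"
    then have "y \<in> P" "rk y \<in> S" "rk y < rk x" using Qsub Q by auto
    then show "monom 1 1 * chain_poly {z \<in> ?Q x. (z, y) \<in> r \<and> z \<noteq> y} r = ?G (rk y)"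
      unfolding eq[OF y] using less.hyps[of y] by simp
  qed
  also have "\<dots> = (\<Sum>y\<in>ideal x. ?G (rk y))"
    by (rule sum.mono_neutral_left[OF fI]) (auto simp: Q)
  also have "\<dots> = (\<Sum>j\<le>rk x. smult (coeff (R_poly (rk x) 0) j) (?G j))"
    using sum_rank_linear[OF fI, of rk "rk x" ?G] rank_mono ideal_rank_sum[OF less.prems] by (simp add: mem_ideal)
  also have "\<dots> = (\<Sum>j<rk x. smult (coeff (R_poly (rk x) 0) j) (?G j))"
    by (rule sum.mono_neutral_right) auto
  also have "1 + \<dots> = below_poly S (rk x)"
    by (subst below_poly.simps) (intro arg_cong2[of _ _ _ _ "(+)"] sum.cong refl, auto)
  finally show ?case .
qed

lemma unique_rank_zero: "coeff (\<Sum>x\<in>P. monom 1 (rk x) :: real poly) 0 = 1"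
proof -
  obtain b where b: "b \<in> P" "\<And>x. x \<in> P \<Longrightarrow> (b, x) \<in> r"
    using partition_poset unfolding partition_poset_def by blast
  have ib: "ideal b = {b}" using b order_antisym by (auto simp: mem_ideal order_carrier)
  obtain C where C: "C \<subseteq> ideal b" "card C = Suc (rk b)"
    using rank_height[OF b(1)] unfolding is_height_def by blast
  have "rk b = 0" using card_mono[of "ideal b" C] C ib by simp
  moreover have "rk x \<noteq> 0" if "x \<in> P" "x \<noteq> b" for x using rank_strict[OF b(2)[OF that(1)]] that(2) by auto
  ultimately have rk0: "rk x = 0 \<longleftrightarrow> x = b" if "x \<in> P" for x using that by blast
  have "(if rk x = 0 then 1 else 0 :: real) = (if x = b then 1 else 0)" if "x \<in> P" for x
    by (simp add: rk0[OF that])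
  then have "(\<Sum>x\<in>P. if rk x = 0 then 1 else 0 :: real) = (\<Sum>x\<in>P. if x = b then 1 else 0)" by (rule sum.cong[OF refl])
  then show ?thesis using b(1) fin by (simp add: coeff_sum)
qed


end


section \<open>Interlacing values in the upper half plane\<close>

text \<open>The signed area \<open>|a| |b| sin (arg b - arg a)\<close>, nonnegative when the
  counterclockwise angle from \<open>a\<close> to \<open>b\<close> is at most a half turn.\<close>

definition cross :: "complex \<Rightarrow> complex \<Rightarrow> real" where
  "cross a b = Im (cnj a * b)"

lemma cross_simps:
  "cross (a + b) c = cross a c + cross b c"
  "cross a (b + c) = cross a b + cross a c"
  "cross (u * a) (u * b) = (cmod u)\<^sup>2 * cross a b"
  "cross a a = 0"
  "cross (of_real s * a) b = s * cross a b"
  "cross a (of_real s * b) = s * cross a b"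
  "cross 0 b = 0"
  "cross a 0 = 0"
  unfolding cmod_power2 by (simp_all add: cross_def algebra_simps power2_eq_square)

lemma cross_self_mult: "cross a (u * a) = (cmod a)\<^sup>2 * Im u"
  unfolding cmod_power2 by (simp add: cross_def algebra_simps power2_eq_square)

lemma cross_sum:
  "cross (sum f A) b = (\<Sum>i\<in>A. cross (f i) b)"
  "cross a (sum g B) = (\<Sum>i\<in>B. cross a (g i))"
  by (induction A rule: infinite_finite_induct; simp add: cross_simps)
    (induction B rule: infinite_finite_induct; simp add: cross_simps)

text \<open>Counterclockwise, \<open>w j\<close> comes no earlier than \<open>w i\<close> and no
  later than \<open>u * w i\<close>. The weak inequalities admit vanishing entries.\<close>

definition interlaced :: "complex \<Rightarrow> (nat \<Rightarrow> complex) \<Rightarrow> nat \<Rightarrow> bool" where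
  "interlaced u w m \<longleftrightarrow> (\<forall>i j. i < j \<and> j < m \<longrightarrow> 0 \<le> cross (w i) (w j) \<and> 0 \<le> cross (w j) (u * w i))"

lemma interlaced_scale: "interlaced u w m \<Longrightarrow> interlaced u (\<lambda>k. s * w k) m"
  by (simp add: interlaced_def cross_simps mult.left_commute[of u s])

text \<open>\<open>cross\<close> is bilinear over the reals, and every term pairs a smaller index
  from \<open>I\<close> with a larger one from \<open>J\<close>.\<close>

lemma cross_sums_nonneg:
  assumes w: "interlaced u w m" and c: "\<And>i. 0 \<le> c i"
    and I: "\<And>i j. i \<in> I \<Longrightarrow> j \<in> J \<Longrightarrow> i < j \<and> j < m"
  shows "0 \<le> cross (\<Sum>i\<in>I. of_real (c i) * w i) (\<Sum>j\<in>J. of_real (c j) * w j)"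
    and "0 \<le> cross (\<Sum>j\<in>J. of_real (c j) * w j) (u * (\<Sum>i\<in>I. of_real (c i) * w i))"
proof -
  have *: "u * (\<Sum>i\<in>I. of_real (c i) * w i) = (\<Sum>i\<in>I. of_real (c i) * (u * w i))"
    by (simp add: sum_distrib_left mult.left_commute)
  show "0 \<le> cross (\<Sum>i\<in>I. of_real (c i) * w i) (\<Sum>j\<in>J. of_real (c j) * w j)"
    using w c I by (auto simp: cross_sum cross_simps interlaced_def intro!: sum_nonneg mult_nonneg_nonneg)
  show "0 \<le> cross (\<Sum>j\<in>J. of_real (c j) * w j) (u * (\<Sum>i\<in>I. of_real (c i) * w i))"
    unfolding * using w c I
    by (auto simp: cross_sum cross_simps interlaced_def intro!: sum_nonneg mult_nonneg_nonneg)
qed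

text \<open>The two shapes of the recursion: tails alone for a rank that is not selected, heads
  turned by \<open>u\<close> plus tails for a selected one.\<close>

lemma interlaced_step:
  assumes w: "interlaced u w m" and c: "\<And>i. 0 \<le> c i" and u: "0 < Im u"
  shows "interlaced u (\<lambda>k. \<Sum>i\<in>{k..<m}. of_real (c i) * w i) (Suc m)"
    and "interlaced u (\<lambda>k. u * (\<Sum>i\<in>{..<k}. of_real (c i) * w i) + (\<Sum>i\<in>{k..<m}. of_real (c i) * w i)) (Suc m)"
proof -
  let ?s = "\<lambda>I. \<Sum>i\<in>I. of_real (c i) * w i"
  have main: "0 \<le> cross (?s {k..<m}) (?s {l..<m}) \<and> 0 \<le> cross (?s {l..<m}) (u * ?s {k..<m}) \<and>
    0 \<le> cross (u * ?s {..<k} + ?s {k..<m}) (u * ?s {..<l} + ?s {l..<m}) \<and>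
    0 \<le> cross (u * ?s {..<l} + ?s {l..<m}) (u * (u * ?s {..<k} + ?s {k..<m}))"
    if kl: "k < l" "l < Suc m" for k l
  proof -
    \<comment> \<open>Cutting at \<open>k\<close> and \<open>l\<close> turns the entries of the
      second shape into \<open>u A + B + C\<close> and \<open>u (A + B) + C\<close>, that is
      \<open>D + B\<close> and \<open>D + u B\<close> with \<open>D = u A + C\<close>, so only
      products of \<open>B\<close> and \<open>D\<close> are left.\<close>
    define A B C where "A = ?s {..<k}" and "B = ?s {k..<l}" and "C = ?s {l..<m}"
    have BC: "?s {k..<m} = B + C"
      using kl by (simp add: B_def C_def sum.atLeastLessThan_concat)
    have AB: "?s {..<l} = A + B"
      using kl by (simp add: A_def B_def lessThan_atLeast0 sum.atLeastLessThan_concat)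
    have n: "0 \<le> cross A B" "0 \<le> cross B (u * A)" "0 \<le> cross A C" "0 \<le> cross C (u * A)"
      "0 \<le> cross B C" "0 \<le> cross C (u * B)"
      unfolding A_def B_def C_def
      by (rule cross_sums_nonneg[OF w c]; use kl in auto)+
    have self: "0 \<le> cross X (u * X)" for X using u by (simp add: cross_self_mult)
    define D where "D = u * A + C"
    have DB: "0 \<le> cross D (u * B)" "0 \<le> cross B D"
      using n by (simp_all add: D_def cross_simps)
    have "cross (B + C) C = cross B C" "cross C (u * (B + C)) = cross C (u * B) + cross C (u * C)"
      by (simp_all add: cross_simps distrib_left)
    moreover have "cross (D + B) (D + u * B) = cross D (u * B) + cross B D + cross B (u * B)"
      by (simp add: cross_simps)
    moreover have "cross (D + u * B) (u * (D + B)) = cross D (u * D) + cross D (u * B) + (cmod u)\<^sup>2 * cross B D"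
      by (simp add: cross_simps distrib_left)
    moreover have D: "u * A + (B + C) = D + B" "u * (A + B) + C = D + u * B"
      by (simp_all add: D_def distrib_left)
    ultimately show ?thesis unfolding BC AB A_def[symmetric] C_def[symmetric] D
      using n DB self[of C] self[of B] self[of D] by simp
  qed
  show "interlaced u (\<lambda>k. ?s {k..<m}) (Suc m)"
    using main by (auto simp: interlaced_def)
  show "interlaced u (\<lambda>k. u * ?s {..<k} + ?s {k..<m}) (Suc m)"
    using main by (auto simp: interlaced_def)
qed

text \<open>If the sum vanished, the terms after the first would add up to \<open>- v\<close>, where
  \<open>v\<close> is the first. But \<open>cross (- v) (u * v) = - |v|^2 Im u < 0\<close>, against
  interlacing.\<close>

lemma interlaced_sum_nonzero:
  assumes w: "interlaced u w (Suc m)" and c: "\<And>i. 0 \<le> c i" and u: "0 < Im u"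
    and "0 < c 0" "w 0 \<noteq> 0"
  shows "(\<Sum>i\<le>m. of_real (c i) * w i) \<noteq> 0"
proof
  assume 0: "(\<Sum>i\<le>m. of_real (c i) * w i) = 0"
  let ?v = "of_real (c 0) * w 0" and ?t = "\<Sum>i\<in>{1..m}. of_real (c i) * w i"
  have "(\<Sum>i\<le>m. of_real (c i) * w i) = ?v + ?t"
    by (simp add: atMost_atLeast0 sum.atLeast_Suc_atMost)
  then have "?t = of_real (-1) * ?v" using 0 by (simp add: add_eq_0_iff)
  moreover have "0 \<le> cross ?t (u * (\<Sum>i\<in>{0}. of_real (c i) * w i))"
    by (rule cross_sums_nonneg(2)[OF w c]) auto
  ultimately have "0 \<le> cross (of_real (-1) * ?v) (u * ?v)" by simp
  also have "\<dots> = - ((cmod ?v)\<^sup>2 * Im u)"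
    by (simp only: cross_simps(5) cross_self_mult)
  finally show False using assms(4,5) u by (simp add: mult_le_0_iff)
qed

lemma Im_div_one_plus_pos:
  assumes "0 < Im z"
  shows "0 < Im (z / (1 + z))"
proof -
  have z1: "1 + z \<noteq> 0" using assms by (auto simp: complex_eq_iff)
  have "Im (z / (1 + z)) = Im z / (cmod (1 + z))\<^sup>2"
    using z1 by (simp add: Im_divide cmod_power2 algebra_simps)
  then show ?thesis using assms z1 by simp
qed

section \<open>Interlacing along the triangular recursion\<close>

text \<open>Unrolled, \<open>rec\<close> gives each entry of row \<open>n + 1\<close> as the
  diagonal one plus a tail of row \<open>n\<close> with positive weights. Both cases of
  \<open>diag\<close> then match a shape in \<open>interlaced_step\<close>, and the full weighted
  sum is nonzero by \<open>interlaced_sum_nonzero\<close>, so the first entry of the row is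
  nonzero.\<close>

lemma interlaced_triangle:
  fixes W :: "nat \<Rightarrow> nat \<Rightarrow> complex" and S :: "nat set"
  assumes z: "0 < Im z"
    and W0: "W 0 0 = (if 0 \<in> S then 1 + z else 1)"
    and rec: "\<And>n k. k \<le> n \<Longrightarrow> W (Suc n) k = W (Suc n) (Suc k) + of_real (real (Suc k)) * W n k"
    and diag: "\<And>n. W (Suc n) (Suc n) = (if Suc n \<in> S then z * (W (Suc n) 0 - W (Suc n) (Suc n)) else 0)"
  shows "interlaced (z / (1 + z)) (W n) (Suc n)" and "W n 0 \<noteq> 0"
proof -
  let ?u = "z / (1 + z)"
  have z1: "1 + z \<noteq> 0" using z by (auto simp: complex_eq_iff)
  note u = Im_div_one_plus_pos[OF z]
  have "interlaced ?u (W n) (Suc n) \<and> W n 0 \<noteq> 0"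
  proof (induction n)
    case 0
    then show ?case using z1 by (auto simp: interlaced_def W0)
  next
    case (Suc n)
    let ?s = "\<lambda>I. \<Sum>i\<in>I. of_real (real (Suc i)) * W n i"
    have W: "W (Suc n) k = W (Suc n) (Suc n) + ?s {k..<Suc n}" if "k \<le> Suc n" for k
      using that
    proof (induction rule: inc_induct)
      case base
      then show ?case by simp
    next
      case (step k)
      then have "?s {k..<Suc n} = of_real (real (Suc k)) * W n k + ?s {Suc k..<Suc n}"
        by (simp only: sum.atLeast_Suc_lessThan)
      then show ?case using rec[of k n] step by (simp del: sum.op_ivl_Suc)
    qed
    have p: "?s {..n} \<noteq> 0"
      by (rule interlaced_sum_nonzero[OF conjunct1[OF Suc.IH] _ u]) (use Suc.IH in auto)
    have at: "{0..<Suc n} = {..n}" by auto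
    have W0': "W (Suc n) 0 = W (Suc n) (Suc n) + ?s {..n}" using W[of 0] unfolding at by simp
    show ?case
    proof (cases "Suc n \<in> S")
      case False
      then have d: "W (Suc n) (Suc n) = 0" using diag[of n] by simp
      have "interlaced ?u (\<lambda>k. ?s {k..<Suc n}) (Suc (Suc n))"
        by (rule interlaced_step(1)[OF conjunct1[OF Suc.IH] _ u]) simp
      then have "interlaced ?u (W (Suc n)) (Suc (Suc n))" 
        unfolding interlaced_def using W d by auto
      then show ?thesis using W0' d p by simp
    next
      case True
      then have d: "W (Suc n) (Suc n) = z * ?s {..n}" using diag[of n] W0' by simp
      \<comment> \<open>The diagonal entry is \<open>z\<close> times the whole sum, so the head
        carries the factor \<open>z = (1 + z) u\<close> and the tail the factor
        \<open>1 + z\<close>; this is where \<open>u\<close> comes from.\<close>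
      have eq: "W (Suc n) k = (1 + z) * (?u * ?s {..<k} + ?s {k..<Suc n})" if "k \<le> Suc n" for k
      proof -
        have "?s {..n} = ?s {..<k} + ?s {k..<Suc n}"
          using that unfolding at[symmetric] lessThan_atLeast0
          by (simp add: sum.atLeastLessThan_concat del: sum.op_ivl_Suc)
        then have "W (Suc n) k = z * ?s {..<k} + (1 + z) * ?s {k..<Suc n}"
          using W[OF that] d by (simp add: algebra_simps)
        also have "z = (1 + z) * ?u" using z1 by simp
        finally show ?thesis using z1 by (simp add: distrib_left)
      qed
      have "interlaced ?u (\<lambda>k. (1 + z) * (?u * ?s {..<k} + ?s {k..<Suc n})) (Suc (Suc n))"
        by (rule interlaced_scale[OF interlaced_step(2)[OF conjunct1[OF Suc.IH] _ u]]) simp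
      then have "interlaced ?u (W (Suc n)) (Suc (Suc n))" 
        unfolding interlaced_def using eq by simp
      moreover have "W (Suc n) 0 = (1 + z) * ?s {..n}" using W0' d by (simp add: algebra_simps)
      ultimately show ?thesis using z1 p by simp
    qed
  qed
  then show "interlaced ?u (W n) (Suc n)" "W n 0 \<noteq> 0" by auto
qed


section \<open>Real-rootedness\<close>

text \<open>The summand \<open>1\<close> at level \<open>0\<close> counts the empty chain: exactly one element has rank \<open>0\<close>.\<close>

definition level_poly :: "nat set \<Rightarrow> nat \<Rightarrow> real poly" where
  "level_poly S j = (if j = 0 then 1 else 0) + (if j \<in> S then monom 1 1 * below_poly S j else 0)"

section \<open>Transfer of the recursion to chain polynomials\<close>

text \<open>The linear map \<open>t^j -> level_poly S j\<close> on degrees up to \<open>n\<close>.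
  It sends the rank polynomial of a partition poset of rank \<open>n\<close> to the chain polynomial
  of the selected ranks.\<close>

definition chain_transform :: "nat set \<Rightarrow> nat \<Rightarrow> real poly \<Rightarrow> real poly" where
  "chain_transform S n f = (\<Sum>j\<le>n. smult (coeff f j) (level_poly S j))"

lemma chain_transform_linear:
  "chain_transform S n (f + g) = chain_transform S n f + chain_transform S n g"
  "chain_transform S n (smult c f) = smult c (chain_transform S n f)"
  by (simp_all add: chain_transform_def smult_add_left sum.distrib smult_sum_right)

lemma chain_transform_sum: "chain_transform S n (sum f A) = (\<Sum>i\<in>A. chain_transform S n (f i))"
proof (induction A rule: infinite_finite_induct)
  case (insert x F)
  then show ?case by (simp add: chain_transform_linear)
qed (simp_all add: chain_transform_def)

text \<open>The recursion of \<open>R_poly\<close> passes through the linear map;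
  \<open>R_poly n k\<close> has degree \<open>n\<close>, so the cutoffs \<open>n\<close> and
  \<open>n + 1\<close> agree on it.\<close>

lemma chain_transform_R_rec:
  assumes "k \<le> n"
  shows "chain_transform S (Suc n) (R_poly (Suc n) k) =
    chain_transform S (Suc n) (R_poly (Suc n) (Suc k)) + smult (real (Suc k)) (chain_transform S n (R_poly n k))"
proof -
  have "chain_transform S (Suc n) (R_poly n k) = chain_transform S n (R_poly n k)"
    using assms by (simp add: chain_transform_def coeff_R_poly_top(2))
  moreover have "R_poly (Suc n) k = R_poly (Suc n) (Suc k) + smult (real (Suc k)) (R_poly n k)"
    using R_poly_rec[of k "Suc n"] assms by simp
  ultimately show ?thesis by (simp only: chain_transform_linear)
qed

lemma chain_transform_R_diag: "chain_transform S n (R_poly n n) = level_poly S n"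
proof -
  have "chain_transform S n (R_poly n n) = (\<Sum>j\<le>n. if j = n then level_poly S n else 0)"
    unfolding chain_transform_def by (intro sum.cong) (auto simp: R_poly_diag)
  then show ?thesis by simp
qed

lemma sum_level_poly:
  assumes "coeff f 0 = 1"
  shows "(\<Sum>j\<le>n. smult (coeff f j) (level_poly S j)) =
    1 + (\<Sum>j\<le>n. if j \<in> S then smult (coeff f j) (monom 1 1 * below_poly S j) else 0)"
proof -
  have "smult (coeff f j) (level_poly S j) = (if j = 0 then 1 else 0) +
      (if j \<in> S then smult (coeff f j) (monom 1 1 * below_poly S j) else 0)" for j
    using assms by (simp add: level_poly_def smult_add_right)
  then show ?thesis by (simp add: sum.distrib)
qed

text \<open>\<open>R_poly (Suc n) 0\<close> is monic, so the top level contributes exactly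
  \<open>level_poly\<close>; the lower levels together make up \<open>below_poly\<close>.\<close>

lemma chain_transform_R_zero:
  "chain_transform S (Suc n) (R_poly (Suc n) 0) = below_poly S (Suc n) + level_poly S (Suc n)"
proof -
  have "chain_transform S (Suc n) (R_poly (Suc n) 0) =
    1 + (\<Sum>j\<le>Suc n. if j \<in> S then smult (coeff (R_poly (Suc n) 0) j) (monom 1 1 * below_poly S j) else 0)"
    unfolding chain_transform_def by (rule sum_level_poly) (rule coeff_R_poly_zero_zero)
  also have "\<dots> = below_poly S (Suc n) + level_poly S (Suc n)"
    unfolding sum.atMost_Suc lessThan_Suc_atMost[symmetric]
    by (simp add: below_poly.simps[of S "Suc n"] level_poly_def coeff_R_poly_top(1))
  finally show ?thesis .
qed

lemma map_poly_of_real_simps: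
  fixes p q :: "real poly"
  shows "map_poly complex_of_real (p + q) = map_poly complex_of_real p + map_poly complex_of_real q"
    and "map_poly complex_of_real (smult c p) = smult (complex_of_real c) (map_poly complex_of_real p)"
    and "map_poly complex_of_real (monom 1 1 * p) = monom 1 1 * map_poly complex_of_real p"
    and "map_poly complex_of_real (sum f A) = (\<Sum>i\<in>A. map_poly complex_of_real (f i))"
proof -
  show add: "map_poly complex_of_real (p + q) = map_poly complex_of_real p + map_poly complex_of_real q" for p q
    by (rule poly_eqI) (simp add: coeff_map_poly)
  show "map_poly complex_of_real (smult c p) = smult (complex_of_real c) (map_poly complex_of_real p)"
    by (rule poly_eqI) (simp add: coeff_map_poly)
  show "map_poly complex_of_real (monom 1 1 * p) = monom 1 1 * map_poly complex_of_real p"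
    by (rule poly_eqI) (simp add: coeff_map_poly coeff_monom_mult)
  show "map_poly complex_of_real (sum f A) = (\<Sum>i\<in>A. map_poly complex_of_real (f i))"
    by (induction A rule: infinite_finite_induct) (simp_all add: add)
qed

lemma chain_transform_nonzero:
  assumes z: "0 < Im z" and h: "\<And>k. 0 \<le> h k" "0 < h 0"
  shows "poly (map_poly complex_of_real (\<Sum>k\<le>n. smult (h k) (chain_transform S n (R_poly n k)))) z \<noteq> 0"
proof -
  define ev where "ev p = poly (map_poly complex_of_real p) z" for p
  have ev: "ev (p + q) = ev p + ev q" "ev (smult c p) = of_real c * ev p"
    "ev (monom 1 1 * p) = z * ev p" "ev 1 = 1" "ev 0 = 0" for p q c
    unfolding ev_def map_poly_of_real_simps by (simp_all add: poly_monom map_poly_1)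
  define W where "W n k = ev (chain_transform S n (R_poly n k))" for n k
  have W0: "W 0 0 = (if 0 \<in> S then 1 + z else 1)"
    unfolding W_def chain_transform_R_diag level_poly_def below_poly.simps[of S 0]
    using ev(3)[of 1] by (simp add: ev(1,2,4,5) del: One_nat_def)
  have rec: "W (Suc n) k = W (Suc n) (Suc k) + of_real (real (Suc k)) * W n k" if "k \<le> n" for n k
    unfolding W_def chain_transform_R_rec[OF that] ev ..
  \<comment> \<open>The difference on the right is the value of \<open>below_poly S (Suc n)\<close>,
    and the diagonal entry is the value of \<open>level_poly S (Suc n)\<close>.\<close>
  have diag: "W (Suc n) (Suc n) = (if Suc n \<in> S then z * (W (Suc n) 0 - W (Suc n) (Suc n)) else 0)" for n
    unfolding W_def chain_transform_R_zero chain_transform_R_diag ev(1)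
    by (simp add: level_poly_def ev del: One_nat_def)
  have il: "interlaced (z / (1 + z)) (W n) (Suc n)" "W n 0 \<noteq> 0"
    by (rule interlaced_triangle[OF z W0 _ diag]; rule rec; assumption)+
  have "(\<Sum>k\<le>n. of_real (h k) * W n k) \<noteq> 0"
    using interlaced_sum_nonzero[of "z / (1 + z)" "W n" n h] il h Im_div_one_plus_pos[OF z] by blast
  moreover have "ev (\<Sum>k\<le>n. smult (h k) (chain_transform S n (R_poly n k))) = (\<Sum>k\<le>n. of_real (h k) * W n k)"
    by (simp add: ev_def W_def map_poly_of_real_simps poly_sum)
  ultimately show ?thesis by (simp add: ev_def)
qed

text \<open>The coefficients are real, so a nonreal zero or its conjugate lies in the upper half
  plane.\<close>

lemma real_rootedI:
  assumes "\<And>z. 0 < Im z \<Longrightarrow> poly (map_poly complex_of_real p) z \<noteq> 0"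
  shows "real_rooted p"
  unfolding real_rooted_def
proof (intro allI impI)
  fix z assume z: "poly (map_poly complex_of_real p) z = 0"
  then have "poly (map_poly complex_of_real p) (cnj z) = 0"
    by (subst real_poly_cnj_root_iff) (simp_all add: coeff_map_poly)
  then have "\<not> 0 < Im z" "\<not> 0 < Im (cnj z)" using assms z by blast+
  then show "z \<in> \<real>" by (simp add: complex_is_Real_iff)
qed

section \<open>Chain polynomials of rank-selected subposets\<close>

context partition_pos
begin

lemma rank_le_poset_rank: "x \<in> P \<Longrightarrow> rk x \<le> poset_rank P r"
  unfolding poset_rank_def using fin by simp

lemma rank_selected_chain_poly:
  "chain_poly (rank_selected P r S) r = chain_transform S (poset_rank P r) (\<Sum>x\<in>P. monom 1 (rk x))"
proof -
  let ?F = "\<Sum>x\<in>P. monom 1 (rk x) :: real poly" and ?n = "poset_rank P r"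
  \<comment> \<open>This is \<open>level_poly\<close> without its constant at level
    \<open>0\<close>; the unique element of rank \<open>0\<close> lets \<open>sum_level_poly\<close>
    absorb the empty chain there.\<close>
  let ?G = "\<lambda>j. if j \<in> S then monom 1 1 * below_poly S j else 0"
  have sub: "rank_selected P r S \<subseteq> P" by (auto simp: rank_selected_def)
  have "chain_poly (rank_selected P r S) r = 1 + (\<Sum>x\<in>rank_selected P r S. ?G (rk x))"
    unfolding chain_poly_rec[OF sub]
  proof (intro arg_cong[of _ _ "(+) 1"] sum.cong refl)
    fix x assume "x \<in> rank_selected P r S"
    then have "x \<in> P" "rk x \<in> S" by (auto simp: rank_selected_def)
    then show "monom 1 1 * chain_poly {z \<in> rank_selected P r S. (z, x) \<in> r \<and> z \<noteq> x} r = ?G (rk x)"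
      by (simp add: rank_selected_chain_poly_below)
  qed
  also have "(\<Sum>x\<in>rank_selected P r S. ?G (rk x)) = (\<Sum>x\<in>P. ?G (rk x))"
    by (rule sum.mono_neutral_left[OF fin sub]) (auto simp: rank_selected_def)
  also have "\<dots> = (\<Sum>j\<le>?n. smult (coeff ?F j) (?G j))"
    by (rule sum_rank_linear[OF fin rank_le_poset_rank])
  also have "1 + \<dots> = chain_transform S ?n ?F"
    unfolding chain_transform_def sum_level_poly[OF unique_rank_zero]
    by (intro arg_cong[of _ _ "(+) 1"] sum.cong) auto
  finally show ?thesis .
qed

lemma real_rooted_rank_selected:
  assumes h: "\<And>k. 0 \<le> h k"
    and F: "(\<Sum>x\<in>P. monom 1 (rk x)) = (\<Sum>k\<le>poset_rank P r. smult (h k) (R_poly (poset_rank P r) k))"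
  shows "real_rooted (chain_poly (rank_selected P r S) r)"
proof (rule real_rootedI)
  fix z :: complex assume z: "0 < Im z"
  let ?n = "poset_rank P r"
  \<comment> \<open>Only \<open>R_poly ?n 0\<close> has a constant term, equal to \<open>1\<close>,
    and one element has rank \<open>0\<close>. Hence \<open>h 0 = 1\<close>, which supplies the
    positive first coefficient for \<open>chain_transform_nonzero\<close>.\<close>
  have "1 = coeff (\<Sum>k\<le>?n. smult (h k) (R_poly ?n k)) 0"
    unfolding F[symmetric] by (rule unique_rank_zero[symmetric])
  also have "\<dots> = (\<Sum>k\<le>?n. h k * coeff (R_poly ?n k) 0)" by (simp add: coeff_sum)
  also have "\<dots> = (\<Sum>k\<le>?n. if k = 0 then h 0 else 0)"
  proof (rule sum.cong[OF refl])
    fix k assume "k \<in> {..?n}"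
    then show "h k * coeff (R_poly ?n k) 0 = (if k = 0 then h 0 else 0)"
      by (cases "k = 0") (simp_all add: coeff_R_poly_zero_zero, simp add: coeff_R_poly coeff_Q_poly_less)
  qed
  finally have "0 < h 0" by simp
  then show "poly (map_poly complex_of_real (chain_poly (rank_selected P r S) r)) z \<noteq> 0"
    unfolding rank_selected_chain_poly F chain_transform_sum chain_transform_linear
    by (rule chain_transform_nonzero[of z h, OF z h])
qed

end

theorem corollary9p5:
  fixes P :: "'a set" and r :: "'a rel"
  assumes "partition_poset P r"
    and "pure_poset P r"
    and "\<exists>ys. Pi_shelling P r ys"
  shows "nonneg_h_vector P r \<and>
         real_rooted (chain_poly P r) \<and>
         (\<forall>S :: nat set. real_rooted (chain_poly (rank_selected P r S) r))"
proof -
  interpret partition_pos P r using assms(1) by unfold_locales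
  obtain ys where "Pi_shelling P r ys" using assms(3) by blast
  then obtain h where h: "\<And>k. 0 \<le> h k"
    "(\<Sum>x\<in>P. monom 1 (rk x)) = (\<Sum>k\<le>poset_rank P r. smult (h k) (R_poly (poset_rank P r) k))"
    using shelling_h_vector[OF assms(2)] by blast
  have "nonneg_h_vector P r"
    unfolding nonneg_h_vector_def using h(1) h_vector_eqI[OF h(2)] by simp
  moreover have rr: "real_rooted (chain_poly (rank_selected P r S) r)" for S
    by (rule real_rooted_rank_selected[OF h])
  moreover have "rank_selected P r UNIV = P" by (simp add: rank_selected_def)
  then have "real_rooted (chain_poly P r)" using rr[of UNIV] by simp
  ultimately show ?thesis by blast
qed

end
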